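(* Let $G$ be a finite simple undirected graph with vertex set $[n]$ and let $I(G)=\langle x_ix_j\mid\{i,j\}\in E(G)\rangle\subset\mathbb{K}[x_1,\dots,x_n]$ be its edge ideal. Then $G$ is perfect if and only if for all integers $r\ge1$ $$I(G)^{(r)}=\Big\langle \prod_{i=1}^{l} m_{V_i}\ \Big|\ V_i\in\mathcal{C}_2(G)\text{ with }\sum_{i=1}^{l}(|V_i|-1)=r\Big\rangle .$$
   Context: $\mathbb{K}$ is an algebraically closed field. For $V\subseteq[n]$, $m_V=\prod_{i\in V}x_i$. $\mathcal{C}_k(G)$ denotes the set of cliques of $G$ (vertex sets inducing a complete subgraph) of cardinality at least $k$. In the generating set, $l$ is any positive integer and the $V_i$ need not be distinct. Symbolic power: for an ideal $I\subset R=\mathbb{K}[x_1,\dots,x_n]$, $I^{(r)}=(R_I^{-1}I^r)\cap R$, where $R_I$ is the complement of the union of the minimal primes of $I$. (For a squarefree monomial ideal $I=\bigcap P_i$ with $P_i$ its minimal monomial primes, $I^{(r)}=\bigcap P_i^r$.) A graph $G$ is perfect if $\omega(G_V)=\chi(G_V)$ for every $V\subseteq[n]$, where $G_V$ is the induced subgraph on $V$, $\omega$ is the clique number and $\chi$ the chromatic number. *)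

theory Defs
  imports
    "HOL-Library.Poly_Mapping"
    "HOL-Library.Ramsey"
    "HOL-Computational_Algebra.Polynomial"
    "HOL-Computational_Algebra.Fraction_Field"
    "HOL-Algebra.Ideal_Product"
begin

text \<open>
  A graph is a vertex set \<open>V\<close> together with an edge set \<open>E \<subseteq> [V]\<^bsup>2\<^esup>\<close> of two-element subsets
  of \<open>V\<close>.
\<close>

definition cliques :: "nat \<Rightarrow> 'v set \<Rightarrow> 'v set set \<Rightarrow> 'v set set" where
  "cliques k V E = {W. W \<subseteq> V \<and> clique W E \<and> k \<le> card W}"

definition induced_edges :: "'v set set \<Rightarrow> 'v set \<Rightarrow> 'v set set" where
  "induced_edges E W = {e \<in> E. e \<subseteq> W}"

definition clique_number :: "'v set \<Rightarrow> 'v set set \<Rightarrow> nat" where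
  "clique_number V E = Max (card ` cliques 0 V E)"

definition proper_colouring :: "'v set \<Rightarrow> 'v set set \<Rightarrow> nat \<Rightarrow> ('v \<Rightarrow> nat) \<Rightarrow> bool" where
  "proper_colouring V E k c \<longleftrightarrow>
     c ` V \<subseteq> {..<k} \<and> (\<forall>u\<in>V. \<forall>v\<in>V. {u, v} \<in> E \<longrightarrow> c u \<noteq> c v)"

definition chromatic_number :: "'v set \<Rightarrow> 'v set set \<Rightarrow> nat" where
  "chromatic_number V E = (LEAST k. \<exists>c. proper_colouring V E k c)"

definition perfect_graph :: "'v set \<Rightarrow> 'v set set \<Rightarrow> bool" where
  "perfect_graph V E \<longleftrightarrow>
     (\<forall>W\<subseteq>V. clique_number W (induced_edges E W) = chromatic_number W (induced_edges E W))"

text \<open>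
  Polynomials in the variables \<open>x\<^sub>0, x\<^sub>1, \<dots>\<close> are finitely supported maps from monomials (themselves
  finitely supported exponent maps) to coefficients. The ring in \<open>x\<^sub>1, \<dots>, x\<^sub>n\<close> is the subring of
  those polynomials in which no other variable occurs.
\<close>

type_synonym 'k mpoly = "(nat \<Rightarrow>\<^sub>0 nat) \<Rightarrow>\<^sub>0 'k"

definition poly_vars :: "'k::zero mpoly \<Rightarrow> nat set" where
  "poly_vars p = (\<Union>m \<in> Poly_Mapping.keys p. Poly_Mapping.keys m)"

definition poly_ring :: "nat \<Rightarrow> 'k::comm_ring_1 mpoly ring" where
  "poly_ring n = \<lparr>carrier = {p. poly_vars p \<subseteq> {1..n}},
     mult = (*), one = 1, zero = 0, add = (+)\<rparr>"

definition var :: "nat \<Rightarrow> 'k::comm_ring_1 mpoly" where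
  "var i = Poly_Mapping.single (Poly_Mapping.single i 1) 1"

definition sqfree_monom :: "nat set \<Rightarrow> 'k::comm_ring_1 mpoly" where
  "sqfree_monom V = (\<Prod>i\<in>V. var i)"

definition edge_ideal :: "nat \<Rightarrow> nat set set \<Rightarrow> 'k::comm_ring_1 mpoly set" where
  "edge_ideal n E = Idl\<^bsub>poly_ring n\<^esub> {var i * var j | i j. {i, j} \<in> E}"

definition minimal_primes :: "('a, 'b) ring_scheme \<Rightarrow> 'a set \<Rightarrow> 'a set set" where
  "minimal_primes R I = {P. primeideal P R \<and> I \<subseteq> P \<and>
     (\<forall>Q. primeideal Q R \<longrightarrow> I \<subseteq> Q \<longrightarrow> Q \<subseteq> P \<longrightarrow> Q = P)}"

text \<open>
  The ring \<open>R\<close> is assumed to be a subring of an integral domain type \<open>'a\<close>, so that the localizations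
  of \<open>R\<close> and of its ideals live inside the fraction field of that type. Powers of an ideal are taken
  in the multiplicative monoid of ideals of \<open>R\<close>.
\<close>

definition localize :: "'a::idom set \<Rightarrow> 'a set \<Rightarrow> 'a fract set" where
  "localize S J = {Fraction_Field.Fract a s | a s. a \<in> J \<and> s \<in> S}"

definition symbolic_power :: "('a::idom, 'b) ring_scheme \<Rightarrow> 'a set \<Rightarrow> nat \<Rightarrow> 'a set" where
  "symbolic_power R I r =
     {f \<in> carrier R. Fraction_Field.Fract f 1 \<in>
        localize (carrier R - \<Union> (minimal_primes R I)) (I [^]\<^bsub>ideals_set R\<^esub> r)}"

end

(* Let I be the edge ideal. The minimal primes of I are generated by the variables of the minimal
   vertex covers C, and x^a lies in the symbolic power of exponent r iff a(C) >= r for all vertex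
   covers C, that is, iff |a| - a(A) >= r for all independent sets A. On the other hand x^a lies in
   the ideal generated by the clique monomials iff a can be covered by at most |a| - r cliques,
   counted with multiplicity. So equality for all r says that for every weight a the minimal number
   of cliques covering a equals the maximal weight of an independent set. This is the weighted form
   of perfection of the complement, and it is equivalent to perfection of G by the weak perfect
   graph theorem, which is proved by Lovasz's replication and counting arguments in a setting that
   is symmetric in cliques and independent sets. *)
theory Submission
  imports Defs
begin

section \<open>Weighted min-max duality\<close>

text \<open>If cliques K_1, ..., K_k contain each vertex x exactly a(x) times, then the numbers
  |K_i| - 1 add up to |a| - k, and singletons contribute nothing. This is why the generators are
  weighted by |V_i| - 1 and why r corresponds to |a| - r cliques. One inclusion of ideals holds for
  every graph, since a vertex cover misses at most one vertex of a clique; perfection enters only in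
  the other.

  Exponents are arbitrary weights, whereas perfection speaks of 0/1 weights; replication bridges
  this gap. The exchange of cliques and independent sets has to be made at the weighted level,
  because the counting function to which the min-max property is applied there takes arbitrary
  values. On the algebraic side no primary decomposition is used: membership in the symbolic power
  is read off the definition by localization, with lowest-degree components for one inclusion and a
  single explicit denominator for the other.\<close>

lemma sum_sum_list_commute:
  fixes f :: "'a \<Rightarrow> 'b \<Rightarrow> 'c::comm_monoid_add"
  shows "(\<Sum>x\<in>K. \<Sum>A\<leftarrow>As. f x A) = (\<Sum>A\<leftarrow>As. \<Sum>x\<in>K. f x A)"
  by (induction As) (simp_all add: sum.distrib)

lemma sum_list_le_length:
  fixes f :: "'a \<Rightarrow> nat"
  assumes "\<And>A. A \<in> set As \<Longrightarrow> f A \<le> c"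
  shows "(\<Sum>A\<leftarrow>As. f A) \<le> length As * c"
  using assms by (induction As) (auto intro: add_mono)

text \<open>Lists serve as multisets of sets. Excess coverage is allowed, so sets may be added to a
  cover or enlarged freely.\<close>

definition covered_by :: "'v set \<Rightarrow> 'v set set \<Rightarrow> ('v \<Rightarrow> nat) \<Rightarrow> nat \<Rightarrow> bool" where
  "covered_by V \<A> w k \<longleftrightarrow>
     (\<exists>As. set As \<subseteq> \<A> \<and> length As \<le> k \<and> (\<forall>x\<in>V. w x \<le> (\<Sum>A\<leftarrow>As. of_bool (x \<in> A))))"

text \<open>Covering number at most maximal weight, the nontrivial half of a duality, phrased
  through all upper bounds \<open>k\<close> so that no maximum has to be formed.\<close>

definition min_max :: "'v set \<Rightarrow> 'v set set \<Rightarrow> 'v set set \<Rightarrow> bool" where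
  "min_max V \<A> \<K> \<longleftrightarrow> (\<forall>w k. (\<forall>K\<in>\<K>. sum w K \<le> k) \<longrightarrow> covered_by V \<A> w k)"

lemma covered_by_Suc:
  assumes "A \<in> \<A>" and "covered_by V \<A> (\<lambda>v. w v - of_bool (v \<in> A)) k"
  shows "covered_by V \<A> w (Suc k)"
proof -
  obtain As where As: "set As \<subseteq> \<A>" "length As \<le> k"
    "\<And>x. x \<in> V \<Longrightarrow> w x - of_bool (x \<in> A) \<le> (\<Sum>B\<leftarrow>As. of_bool (x \<in> B))"
    using assms(2) by (auto simp: covered_by_def)
  have "w x \<le> (\<Sum>B\<leftarrow>A # As. of_bool (x \<in> B))" if "x \<in> V" for x
    using As(3)[OF that] by simp
  then show ?thesis
    unfolding covered_by_def using As(1,2) assms(1)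
    by (intro exI[of _ "A # As"]) auto
qed

text \<open>Independent sets and cliques satisfy these axioms in either order, so the exchange
  argument is proved once and applied both ways. The families interact only through
  \<open>meet\<close>, which gives the trivial half of the duality.\<close>

locale dual_families =
  fixes V :: "'v set" and \<A> \<K> :: "'v set set"
  assumes finite_V: "finite V"
    and A_sub: "A \<in> \<A> \<Longrightarrow> A \<subseteq> V"
    and K_sub: "K \<in> \<K> \<Longrightarrow> K \<subseteq> V"
    and A_down: "A \<in> \<A> \<Longrightarrow> B \<subseteq> A \<Longrightarrow> B \<in> \<A>"
    and K_down: "K \<in> \<K> \<Longrightarrow> L \<subseteq> K \<Longrightarrow> L \<in> \<K>"
    and A_single: "x \<in> V \<Longrightarrow> {x} \<in> \<A>"
    and K_empty: "{} \<in> \<K>"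
    and meet: "A \<in> \<A> \<Longrightarrow> K \<in> \<K> \<Longrightarrow> card (A \<inter> K) \<le> 1"
begin

lemma finite_A: "A \<in> \<A> \<Longrightarrow> finite A"
  using A_sub finite_V finite_subset by blast

lemma finite_K: "K \<in> \<K> \<Longrightarrow> finite K"
  using K_sub finite_V finite_subset by blast

lemma sum_cover_eq:
  assumes "K \<in> \<K>"
  shows "(\<Sum>x\<in>K. \<Sum>A\<leftarrow>As. of_bool (x \<in> A)) = (\<Sum>A\<leftarrow>As. card (A \<inter> K))"
proof -
  have "(\<Sum>x\<in>K. of_bool (x \<in> A)) = card (A \<inter> K)" for A
    using finite_K[OF assms] by (simp add: Int_commute Int_def)
  then show ?thesis
    by (simp add: sum_sum_list_commute)
qed

text \<open>The trivial half of the duality: each set of the cover meets \<open>K\<close> at most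
  once and so pays for at most one unit of its weight.\<close>

lemma weight_le_length:
  assumes "K \<in> \<K>" "set As \<subseteq> \<A>" "\<And>x. x \<in> K \<Longrightarrow> w x \<le> (\<Sum>A\<leftarrow>As. of_bool (x \<in> A))"
  shows "sum w K \<le> length As"
proof -
  have "sum w K \<le> (\<Sum>x\<in>K. \<Sum>A\<leftarrow>As. of_bool (x \<in> A))"
    by (intro sum_mono assms)
  also have "\<dots> \<le> length As * 1"
    unfolding sum_cover_eq[OF assms(1)]
    using meet assms(1,2) by (intro sum_list_le_length) auto
  finally show ?thesis by simp
qed

text \<open>
  The weighted replication lemma: if \<open>w x \<ge> 2\<close>, cover \<open>w - x\<close> by \<open>k\<close> sets. One of them contains
  \<open>x\<close>, and subtracting it from \<open>w\<close> lowers the maximal weight of a set in \<open>\<K>\<close>.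
\<close>

lemma min_max_if_unweighted:
  assumes unw: "\<And>W k. W \<subseteq> V \<Longrightarrow> (\<And>K. K \<in> \<K> \<Longrightarrow> card (K \<inter> W) \<le> k) \<Longrightarrow>
                  covered_by V \<A> (\<lambda>x. of_bool (x \<in> W)) k"
  shows "min_max V \<A> \<K>"
proof -
  have "covered_by V \<A> w k" if "\<forall>K\<in>\<K>. sum w K \<le> k" for w k
    using that
  proof (induction "sum w V" arbitrary: w k rule: less_induct)
    case less
    show ?case
    proof (cases "\<exists>x\<in>V. w x \<ge> 2")
      case False
      define W where "W = {v \<in> V. w v = 1}"
      have w: "w x = of_bool (x \<in> W)" if "x \<in> V" for x
        using False that by (force simp: W_def)
      have "card (K \<inter> W) \<le> k" if "K \<in> \<K>" for K
      proof -
        have "card (K \<inter> W) = (\<Sum>x\<in>K. of_bool (x \<in> W))"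
          using finite_K[OF that] by (simp add: Int_def)
        also have "\<dots> = sum w K"
          using K_sub[OF that] w by (intro sum.cong) auto
        finally show ?thesis using less.prems that by simp
      qed
      moreover have "W \<subseteq> V" by (auto simp: W_def)
      ultimately have "covered_by V \<A> (\<lambda>x. of_bool (x \<in> W)) k"
        using unw by blast
      then show ?thesis using w by (simp add: covered_by_def)
    next
      case True
      then obtain x where x: "x \<in> V" "w x \<ge> 2" by blast
      define w1 where "w1 = w(x := w x - 1)"
      have w1_le: "w1 v \<le> w v" for v by (simp add: w1_def)
      have "sum w1 V < sum w V"
        using x finite_V w1_le by (intro sum_strict_mono_ex1) (auto simp: w1_def intro!: bexI[of _ x])
      moreover have "\<forall>K\<in>\<K>. sum w1 K \<le> k"
        using less.prems w1_le by (meson le_trans sum_mono)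
      ultimately have "covered_by V \<A> w1 k"
        using less.hyps by blast
      then obtain As where As: "set As \<subseteq> \<A>" "length As \<le> k"
        "\<And>v. v \<in> V \<Longrightarrow> w1 v \<le> (\<Sum>A\<leftarrow>As. of_bool (v \<in> A))"
        by (auto simp: covered_by_def)
      \<comment> \<open>Here \<open>w x \<ge> 2\<close> is used: \<open>w1 x\<close> is still
        positive, so the cover of \<open>w1\<close> must reach \<open>x\<close>.\<close>
      have "\<exists>A\<in>set As. x \<in> A"
      proof (rule ccontr)
        assume "\<not> (\<exists>A\<in>set As. x \<in> A)"
        then have "(\<Sum>A\<leftarrow>As. of_bool (x \<in> A)) \<le> length As * (0::nat)"
          by (intro sum_list_le_length) auto
        with As(3)[OF x(1)] have "w1 x \<le> length As * 0" by (rule le_trans)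
        then show False using x(2) by (simp add: w1_def)
      qed
      then obtain A where A: "A \<in> set As" "x \<in> A" by blast
      define w2 where "w2 = (\<lambda>v. w v - of_bool (v \<in> A))"
      have w2_le: "w2 v \<le> w1 v" for v
        using A by (simp add: w1_def w2_def)
      have kpos: "k > 0" using A As(2) by (cases As) auto
      have w2_bound: "sum w2 K \<le> k - 1" if K: "K \<in> \<K>" for K
      proof (rule ccontr)
        assume "\<not> sum w2 K \<le> k - 1"
        then have ge: "k \<le> sum w2 K" by simp
        \<comment> \<open>Vertices of weight zero are dropped so that a vertex shared with
          \<open>A\<close> really loses weight: \<open>w1 v > 0\<close> gives
          \<open>w2 v < w v\<close>.\<close>
        define K' where "K' = {v \<in> K. w1 v > 0}"
        have K': "K' \<in> \<K>" using K_down[OF K] by (auto simp: K'_def)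
        have "sum w1 K' = sum w1 K"
          using finite_K[OF K] by (intro sum.mono_neutral_left) (auto simp: K'_def)
        moreover have "sum w2 K \<le> sum w1 K" by (intro sum_mono w2_le)
        ultimately have ge1: "k \<le> sum w1 K'" using ge by simp
        have "\<exists>v. v \<in> A \<inter> K'"
        proof (rule ccontr)
          assume "\<not> (\<exists>v. v \<in> A \<inter> K')"
          then have disj: "v \<notin> A" if "v \<in> K'" for v using that by blast
          \<comment> \<open>If \<open>A\<close> misses \<open>K'\<close>, the remaining sets still
            cover \<open>w1\<close> on \<open>K'\<close>, and there are at most \<open>k - 1\<close>
            of them.\<close>
          obtain ys zs where As_eq: "As = ys @ A # zs"
            using A(1) split_list by metis
          have "sum w1 K' \<le> length (ys @ zs)"
          proof (rule weight_le_length[OF K'])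
            show "set (ys @ zs) \<subseteq> \<A>" using As(1) As_eq by auto
            show "w1 v \<le> (\<Sum>B\<leftarrow>ys @ zs. of_bool (v \<in> B))" if "v \<in> K'" for v
              using As(3)[of v] disj[OF that] that K_sub[OF K'] by (auto simp: As_eq)
          qed
          then show False using ge1 As(2) As_eq by simp
        qed
        then obtain v where v: "v \<in> A" "v \<in> K" "w1 v > 0"
          by (auto simp: K'_def)
        have lt: "w2 v < w v" using v w1_le[of v] by (simp add: w2_def)
        have "sum w2 K < sum w K"
          using v lt finite_K[OF K] by (intro sum_strict_mono_ex1) (auto simp: w2_def intro!: bexI[of _ v])
        then show False using less.prems K ge by auto
      qed
      have "sum w2 V < sum w V"
        using x A finite_V by (intro sum_strict_mono_ex1) (auto simp: w2_def intro!: bexI[of _ x])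
      then have "covered_by V \<A> w2 (k - 1)"
        using less.hyps w2_bound by blast
      then have "covered_by V \<A> w (Suc (k - 1))"
        using covered_by_Suc[of A \<A> V w "k - 1"] A(1) As(1) unfolding w2_def by blast
      then show ?thesis using kpos by simp
    qed
  qed
  then show ?thesis by (simp add: min_max_def)
qed

text \<open>
  If each \<open>K\<close> misses a member \<open>F K\<close> of \<open>\<A>\<close> of maximal weight, let \<open>h x\<close> count the \<open>K\<close> with
  \<open>x \<in> F K\<close>. Then \<open>h\<close> is covered by fewer than \<open>card \<K>\<close> sets, and computing the sum of \<open>w x * h x\<close>
  in two ways gives a contradiction.
\<close>

lemma exists_transversal:
  assumes mm: "min_max V \<A> \<K>" and bound: "\<And>A. A \<in> \<A> \<Longrightarrow> sum w A \<le> Suc k"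
  shows "\<exists>K\<in>\<K>. \<forall>A\<in>\<A>. sum w A = Suc k \<longrightarrow> K \<inter> A \<noteq> {}"
proof (rule ccontr)
  assume "\<not> ?thesis"
  then have "\<forall>K\<in>\<K>. \<exists>A. A \<in> \<A> \<and> sum w A = Suc k \<and> K \<inter> A = {}" by blast
  then obtain F where F: "\<And>K. K \<in> \<K> \<Longrightarrow> F K \<in> \<A> \<and> sum w (F K) = Suc k \<and> K \<inter> F K = {}"
    by metis
  have fin: "finite \<K>"
    using K_sub finite_V by (meson PowI finite_Pow_iff finite_subset subsetI)
  define h where "h x = (\<Sum>K\<in>\<K>. of_bool (x \<in> F K) :: nat)" for x
  \<comment> \<open>As \<open>\<K>\<close> contains the empty set, the subtraction in
    \<open>card \<K> - 1\<close> is not truncated.\<close>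
  have cardpos: "card \<K> > 0" using fin K_empty by (auto simp: card_gt_0_iff)
  have "sum h X \<le> card \<K> - 1" if X: "X \<in> \<K>" for X
  proof -
    have "sum h X = (\<Sum>K\<in>\<K>. card (F K \<inter> X))"
      unfolding h_def using finite_K[OF X]
      by (subst sum.swap) (simp add: Int_commute Int_def)
    \<comment> \<open>The term of \<open>X\<close> itself vanishes because \<open>F X\<close> avoids
      \<open>X\<close>; this saves the one set on which the contradiction rests.\<close>
    also have "\<dots> = (\<Sum>K\<in>\<K> - {X}. card (F K \<inter> X))"
      using F[OF X] X fin by (simp add: sum.remove Int_commute)
    also have "\<dots> \<le> (\<Sum>K\<in>\<K> - {X}. 1)"
      using F X meet by (intro sum_mono) auto
    also have "\<dots> = card \<K> - 1" using X fin by simp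
    finally show ?thesis .
  qed
  then have "covered_by V \<A> h (card \<K> - 1)"
    using mm by (auto simp: min_max_def)
  then obtain As where As: "set As \<subseteq> \<A>" "length As \<le> card \<K> - 1"
    "\<And>x. x \<in> V \<Longrightarrow> h x \<le> (\<Sum>A\<leftarrow>As. of_bool (x \<in> A))"
    by (auto simp: covered_by_def)
  have w_of: "(\<Sum>x\<in>V. w x * of_bool (x \<in> A)) = sum w A" if "A \<in> \<A>" for A
  proof -
    have "(\<Sum>x\<in>V. w x * of_bool (x \<in> A)) = (\<Sum>x\<in>A. w x * of_bool (x \<in> A))"
      using A_sub[OF that] finite_V by (intro sum.mono_neutral_right) auto
    then show ?thesis by simp
  qed
  have "card \<K> * Suc k = (\<Sum>K\<in>\<K>. sum w (F K))"
    using F by simp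
  also have "\<dots> = (\<Sum>K\<in>\<K>. \<Sum>x\<in>V. w x * of_bool (x \<in> F K))"
    using F by (intro sum.cong[OF refl] w_of[symmetric]) blast
  also have "\<dots> = (\<Sum>x\<in>V. w x * h x)"
    unfolding h_def sum_distrib_left by (rule sum.swap)
  also have "\<dots> \<le> (\<Sum>x\<in>V. w x * (\<Sum>A\<leftarrow>As. of_bool (x \<in> A)))"
    using As(3) by (intro sum_mono mult_left_mono) auto
  also have "\<dots> = (\<Sum>A\<leftarrow>As. \<Sum>x\<in>V. w x * of_bool (x \<in> A))"
    by (simp only: sum_list_const_mult[symmetric] sum_sum_list_commute)
  also have "\<dots> \<le> length As * Suc k"
    using As(1) w_of bound by (intro sum_list_le_length) auto
  also have "\<dots> \<le> (card \<K> - 1) * Suc k"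
    using As(2) by (rule mult_right_mono) simp
  finally have "card \<K> \<le> card \<K> - 1" by (simp only: mult_le_cancel2)
  then show False using cardpos by simp
qed

text \<open>Induction on the bound: subtracting a transversal of the members of \<open>\<A>\<close>
  of maximal weight lowers all these weights, so the bound drops by one for each set of
  \<open>\<K>\<close> spent. The transversal comes from the duality in the original
  direction.\<close>

lemma min_max_swap:
  assumes mm: "min_max V \<A> \<K>"
  shows "min_max V \<K> \<A>"
proof -
  have "covered_by V \<K> w k" if "\<forall>A\<in>\<A>. sum w A \<le> k" for w k
    using that
  proof (induction k arbitrary: w)
    case 0
    \<comment> \<open>All singletons lie in \<open>\<A>\<close>, so the bound \<open>0\<close> makes
      \<open>w\<close> vanish on \<open>V\<close> and the empty cover suffices.\<close>
    have "w x = 0" if "x \<in> V" for x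
      using 0 A_single[OF that] by fastforce
    then show ?case by (auto simp: covered_by_def intro!: exI[of _ "[]"])
  next
    case (Suc k)
    define supp where "supp = {v. w v > 0}"
    obtain K where K: "K \<in> \<K>" "\<And>A. A \<in> \<A> \<Longrightarrow> sum w A = Suc k \<Longrightarrow> K \<inter> A \<noteq> {}"
      using exists_transversal[OF mm, of w k] Suc.prems by blast
    define w' where "w' = (\<lambda>v. w v - of_bool (v \<in> K))"
    have "sum w' A \<le> k" if A: "A \<in> \<A>" for A
    proof (cases "sum w A = Suc k")
      case False
      then have "sum w A \<le> k" using Suc.prems A by (auto simp: le_Suc_eq)
      moreover have "sum w' A \<le> sum w A" by (intro sum_mono) (simp add: w'_def)
      ultimately show ?thesis by simp
    next
      case True
      \<comment> \<open>Meeting \<open>A\<close> is not enough, since the common vertex could have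
        weight zero. The support of \<open>w\<close> in \<open>A\<close> has the same maximal
        weight, so \<open>K\<close> meets that as well.\<close>
      have "sum w (A \<inter> supp) = sum w A"
        using finite_A[OF A] by (intro sum.mono_neutral_left) (auto simp: supp_def)
      then obtain v where v: "v \<in> K" "v \<in> A" "w v > 0"
        using K(2)[of "A \<inter> supp"] A_down[OF A] True by (auto simp: supp_def)
      then have "sum w' A < sum w A"
        using finite_A[OF A] by (intro sum_strict_mono_ex1) (auto simp: w'_def intro!: bexI[of _ v])
      then show ?thesis using True by simp
    qed
    then have "covered_by V \<K> w' k" using Suc.IH by blast
    then show ?case using covered_by_Suc[OF K(1), of V w k] by (simp add: w'_def)
  qed
  then show ?thesis by (simp add: min_max_def)
qed

end

section \<open>Perfect graphs and clique packings\<close>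

definition vertex_cover :: "'v set \<Rightarrow> 'v set set \<Rightarrow> 'v set \<Rightarrow> bool" where
  "vertex_cover V E C \<longleftrightarrow> C \<subseteq> V \<and> (\<forall>e\<in>E. e \<inter> C \<noteq> {})"

definition minimal_vertex_cover :: "'v set \<Rightarrow> 'v set set \<Rightarrow> 'v set \<Rightarrow> bool" where
  "minimal_vertex_cover V E C \<longleftrightarrow>
     vertex_cover V E C \<and> (\<forall>D. vertex_cover V E D \<longrightarrow> D \<subseteq> C \<longrightarrow> D = C)"

lemma obtain_minimal_vertex_cover:
  assumes "finite V" "vertex_cover V E D"
  obtains C where "minimal_vertex_cover V E C" "C \<subseteq> D"
proof -
  have fin: "finite {C. vertex_cover V E C \<and> C \<subseteq> D}"
    using assms(1) by (rule rev_finite_subset[OF finite_Pow_iff[THEN iffD2]]) (auto simp: vertex_cover_def)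
  obtain C where "C \<in> {C. vertex_cover V E C \<and> C \<subseteq> D}"
    "\<And>B. B \<in> {C. vertex_cover V E C \<and> C \<subseteq> D} \<Longrightarrow> B \<subseteq> C \<Longrightarrow> B = C"
    using finite_has_minimal[OF fin] assms(2) by (auto simp: eq_commute)
  then show thesis using that[of C] by (auto simp: minimal_vertex_cover_def)
qed

lemma dual_families_graph:
  assumes "finite V"
  shows "dual_families V {A. A \<subseteq> V \<and> indep A E} {K. K \<subseteq> V \<and> clique K E}"
    and "dual_families V {K. K \<subseteq> V \<and> clique K E} {A. A \<subseteq> V \<and> indep A E}"
proof -
  have meet: "card (A \<inter> K) \<le> 1" if "A \<subseteq> V" "indep A E" "clique K E" for A K
  proof -
    have "finite (A \<inter> K)" using that(1) assms finite_subset by blast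
    moreover have "x = y" if "x \<in> A \<inter> K" "y \<in> A \<inter> K" for x y
      using that \<open>indep A E\<close> \<open>clique K E\<close> by (auto simp: indep_def clique_def)
    ultimately have "card (A \<inter> K) \<le> Suc 0" using card_le_Suc0_iff_eq[of "A \<inter> K"] by blast
    then show ?thesis by simp
  qed
  then have meet': "card (K \<inter> A) \<le> 1" if "A \<subseteq> V" "indep A E" "clique K E" for A K
    using that by (simp add: Int_commute)
  show "dual_families V {A. A \<subseteq> V \<and> indep A E} {K. K \<subseteq> V \<and> clique K E}"
    by unfold_locales (use assms meet in \<open>auto simp: smaller_indep smaller_clique indep_def[of "{_}"]\<close>)
  show "dual_families V {K. K \<subseteq> V \<and> clique K E} {A. A \<subseteq> V \<and> indep A E}"
    by unfold_locales (use assms meet' in \<open>auto simp: smaller_indep smaller_clique clique_def[of "{_}"]\<close>)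
qed

lemma sum_list_of_bool_ge_1:
  "A \<in> set As \<Longrightarrow> x \<in> A \<Longrightarrow> (\<Sum>A\<leftarrow>As. of_bool (x \<in> A) :: nat) \<ge> 1"
  by (induction As) auto

lemma cliques_induced:
  "W \<subseteq> V \<Longrightarrow> cliques 0 W (induced_edges E W) = {K. K \<subseteq> W \<and> clique K E}"
  by (auto simp: cliques_def induced_edges_def clique_def)

lemma proper_colouring_induced:
  "proper_colouring W (induced_edges E W) k c \<longleftrightarrow>
     c ` W \<subseteq> {..<k} \<and> (\<forall>u\<in>W. \<forall>v\<in>W. {u, v} \<in> E \<longrightarrow> c u \<noteq> c v)"
  by (auto simp: proper_colouring_def induced_edges_def)

lemma chromatic_number_le:
  "proper_colouring V E k c \<Longrightarrow> chromatic_number V E \<le> k"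
  unfolding chromatic_number_def by (rule Least_le) blast

text \<open>For 0/1 weights a cover by independent sets is a colouring, and the maximal weight of a
  clique is the clique number of an induced subgraph. Perfection is therefore the 0/1 case, which
  replication extends to all weights.\<close>

lemma perfect_graph_iff_min_max:
  fixes V :: "'v set"
  assumes fin: "finite V" and loopless: "\<And>v. {v} \<notin> E"
  shows "perfect_graph V E \<longleftrightarrow>
    min_max V {A. A \<subseteq> V \<and> indep A E} {K. K \<subseteq> V \<and> clique K E}" (is "_ \<longleftrightarrow> min_max V ?A ?K")
proof -
  interpret dual_families V ?A ?K by (rule dual_families_graph[OF fin])
  have cn_ge: "card K \<le> clique_number W (induced_edges E W)"
    if "W \<subseteq> V" "K \<subseteq> W" "clique K E" for W K
  proof -
    have "finite {K. K \<subseteq> W \<and> clique K E}" using fin that(1) finite_subset by fastforce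
    then show ?thesis
      unfolding clique_number_def cliques_induced[OF that(1)] using that by (intro Max_ge) auto
  qed
  have cn_in: "\<exists>K. K \<subseteq> W \<and> clique K E \<and> clique_number W (induced_edges E W) = card K"
    if "W \<subseteq> V" for W
  proof -
    have "finite {K. K \<subseteq> W \<and> clique K E}" using fin that(1) finite_subset by fastforce
    moreover have "{K. K \<subseteq> W \<and> clique K E} \<noteq> {}" by (auto intro: exI[of _ "{}"])
    ultimately have "Max (card ` {K. K \<subseteq> W \<and> clique K E}) \<in> card ` {K. K \<subseteq> W \<and> clique K E}"
      by (intro Max_in) auto
    then show ?thesis unfolding clique_number_def cliques_induced[OF that] by auto
  qed
  have colouring: "\<exists>c. proper_colouring W (induced_edges E W) (chromatic_number W (induced_edges E W)) c"
    if "W \<subseteq> V" for W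
  proof -
    \<comment> \<open>The \<open>LEAST\<close> in \<open>chromatic_number\<close> is attained only
      if some proper colouring exists; in the absence of loops an injective one is proper.\<close>
    have "finite W" using fin that finite_subset by blast
    then obtain c :: "'v \<Rightarrow> nat" and m where c: "c ` W = {i. i < m}" "inj_on c W"
      using finite_imp_inj_to_nat_seg[of W] by metis
    have "c u \<noteq> c v" if "u \<in> W" "v \<in> W" "{u, v} \<in> E" for u v
      using loopless[of u] that c(2) by (metis inj_on_def insert_absorb2)
    then have "proper_colouring W (induced_edges E W) m c"
      using c(1) by (auto simp: proper_colouring_induced)
    then have "\<exists>c. proper_colouring W (induced_edges E W) m c" by blast
    then show ?thesis
      unfolding chromatic_number_def
      by (rule LeastI[of "\<lambda>k. \<exists>c. proper_colouring W (induced_edges E W) k c"])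
  qed
  show ?thesis
  proof
    assume perfect: "perfect_graph V E"
    show "min_max V ?A ?K"
    proof (rule min_max_if_unweighted)
      fix W k assume W: "W \<subseteq> V" and k: "\<And>K. K \<in> ?K \<Longrightarrow> card (K \<inter> W) \<le> k"
      let ?\<chi> = "chromatic_number W (induced_edges E W)"
      have \<chi>k: "?\<chi> \<le> k"
      proof -
        obtain K where K: "K \<subseteq> W" "clique K E" "clique_number W (induced_edges E W) = card K"
          using cn_in[OF W] by blast
        then have "card K \<le> k" using k[of K] W by (simp add: Int_absorb2)
        then show ?thesis using perfect W K(3) by (simp add: perfect_graph_def)
      qed
      obtain c where c: "c ` W \<subseteq> {..<?\<chi>}" "\<And>u v. u \<in> W \<Longrightarrow> v \<in> W \<Longrightarrow> {u, v} \<in> E \<Longrightarrow> c u \<noteq> c v"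
        using colouring[OF W] by (auto simp: proper_colouring_induced)
      define As where "As = map (\<lambda>i. {v \<in> W. c v = i}) [0..<?\<chi>]"
      have "set As \<subseteq> ?A" using W c(2) by (fastforce simp: As_def indep_def)
      moreover have "length As \<le> k" using \<chi>k by (simp add: As_def)
      moreover have "of_bool (x \<in> W) \<le> (\<Sum>A\<leftarrow>As. of_bool (x \<in> A) :: nat)" for x
      proof (cases "x \<in> W")
        case True
        then have "{v \<in> W. c v = c x} \<in> set As" using c(1) by (auto simp: As_def)
        then have "(\<Sum>A\<leftarrow>As. of_bool (x \<in> A) :: nat) \<ge> 1"
          by (rule sum_list_of_bool_ge_1) (simp add: True)
        then show ?thesis using True by simp
      qed simp
      ultimately show "covered_by V ?A (\<lambda>x. of_bool (x \<in> W)) k"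
        unfolding covered_by_def by blast
    qed
  next
    assume mm: "min_max V ?A ?K"
    show "perfect_graph V E"
      unfolding perfect_graph_def
    proof (intro allI impI antisym)
      fix W assume W: "W \<subseteq> V"
      let ?\<omega> = "clique_number W (induced_edges E W)"
      let ?\<chi> = "chromatic_number W (induced_edges E W)"
      obtain K where K: "K \<subseteq> W" "clique K E" "?\<omega> = card K"
        using cn_in[OF W] by blast
      obtain c where c: "c ` W \<subseteq> {..<?\<chi>}" "\<And>u v. u \<in> W \<Longrightarrow> v \<in> W \<Longrightarrow> {u, v} \<in> E \<Longrightarrow> c u \<noteq> c v"
        using colouring[OF W] by (auto simp: proper_colouring_induced)
      have "inj_on c K"
        using K(1,2) c(2) unfolding inj_on_def clique_def by blast
      then have "card K \<le> card {..<?\<chi>}"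
        using K(1) c(1) by (intro card_inj_on_le[of c]) auto
      then show "?\<omega> \<le> ?\<chi>" using K(3) by simp
      have "sum (\<lambda>x. of_bool (x \<in> W)) L \<le> ?\<omega>" if "L \<in> ?K" for L
      proof -
        have "finite L" using finite_K[OF that] .
        then have "sum (\<lambda>x. of_bool (x \<in> W)) L = card (L \<inter> W)" by (simp add: Int_def)
        then show ?thesis using cn_ge[OF W, of "L \<inter> W"] that smaller_clique by fastforce
      qed
      then have "covered_by V ?A (\<lambda>x. of_bool (x \<in> W)) ?\<omega>"
        using mm by (simp add: min_max_def)
      then obtain As where As: "set As \<subseteq> ?A" "length As \<le> ?\<omega>"
        "\<And>x. x \<in> V \<Longrightarrow> of_bool (x \<in> W) \<le> (\<Sum>A\<leftarrow>As. of_bool (x \<in> A) :: nat)"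
        unfolding covered_by_def by blast
      have "\<exists>i<length As. x \<in> As ! i" if "x \<in> W" for x
      proof (rule ccontr)
        assume "\<not> ?thesis"
        then have "x \<notin> A" if "A \<in> set As" for A using that by (metis in_set_conv_nth)
        then have "(\<Sum>A\<leftarrow>As. of_bool (x \<in> A)) \<le> length As * (0::nat)"
          by (intro sum_list_le_length) auto
        with As(3)[of x] have "of_bool (x \<in> W) \<le> length As * (0::nat)"
          using that W by (meson le_trans subsetD)
        then show False using that by simp
      qed
      \<comment> \<open>A vertex may lie in several sets of the cover; \<open>d\<close> picks the
        index of one of them as its colour.\<close>
      then obtain d where d: "\<And>x. x \<in> W \<Longrightarrow> d x < length As" "\<And>x. x \<in> W \<Longrightarrow> x \<in> As ! d x"
        by metis
      have "proper_colouring W (induced_edges E W) ?\<omega> d"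
        unfolding proper_colouring_induced
      proof (intro conjI ballI impI)
        show "d ` W \<subseteq> {..<?\<omega>}" using d(1) As(2) by fastforce
        fix u v assume uv: "u \<in> W" "v \<in> W" "{u, v} \<in> E"
        show "d u \<noteq> d v"
        proof
          assume eq: "d u = d v"
          have "indep (As ! d u) E" using As(1) d(1)[OF uv(1)] nth_mem by blast
          moreover have "u \<noteq> v" using uv(3) loopless[of u] by auto
          ultimately show False using d(2)[OF uv(1)] d(2)[OF uv(2)] uv(3) eq by (auto simp: indep_def)
        qed
      qed
      then show "?\<chi> \<le> ?\<omega>" by (rule chromatic_number_le)
    qed
  qed
qed

text \<open>The passage to the complement: the swap is applied once in each orientation of the two
  families.\<close>

corollary perfect_graph_iff_clique_cover:
  assumes "finite V" and "\<And>v. {v} \<notin> E"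
  shows "perfect_graph V E \<longleftrightarrow>
    min_max V {K. K \<subseteq> V \<and> clique K E} {A. A \<subseteq> V \<and> indep A E}"
  unfolding perfect_graph_iff_min_max[OF assms]
  using dual_families.min_max_swap[OF dual_families_graph(1)[OF assms(1), of E]]
    dual_families.min_max_swap[OF dual_families_graph(2)[OF assms(1), of E]] by (rule iffI)

text \<open>The combinatorial form of divisibility of the monomial with exponent \<open>w\<close> by
  a product of clique monomials. The empty list is allowed, so \<open>r = 0\<close> is always
  packed.\<close>

definition packs :: "'v set \<Rightarrow> 'v set set \<Rightarrow> ('v \<Rightarrow> nat) \<Rightarrow> nat \<Rightarrow> bool" where
  "packs V E w r \<longleftrightarrow> (\<exists>Ks. set Ks \<subseteq> cliques 2 V E \<and> (\<Sum>K\<leftarrow>Ks. card K - 1) = r \<and>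
     (\<forall>x\<in>V. (\<Sum>K\<leftarrow>Ks. of_bool (x \<in> K)) \<le> w x))"

lemma packs_zero: "packs V E w 0"
  unfolding packs_def by (rule exI[of _ "[]"]) simp

lemma packs_mono:
  assumes "packs V E w r" and le: "\<And>x. x \<in> V \<Longrightarrow> w x \<le> w' x"
  shows "packs V E w' r"
proof -
  obtain Ks where "set Ks \<subseteq> cliques 2 V E" "(\<Sum>K\<leftarrow>Ks. card K - 1) = r"
    "\<And>x. x \<in> V \<Longrightarrow> (\<Sum>K\<leftarrow>Ks. of_bool (x \<in> K)) \<le> w x"
    using assms(1) unfolding packs_def by blast
  then show ?thesis
    unfolding packs_def using le by (intro exI[of _ Ks]) (auto intro: le_trans)
qed

lemma packs_Cons:
  assumes "K \<in> cliques 2 V E" "\<And>x. x \<in> K \<Longrightarrow> w x > 0" "packs V E (\<lambda>x. w x - of_bool (x \<in> K)) r"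
  shows "packs V E w (card K - 1 + r)"
proof -
  obtain Ks where Ks: "set Ks \<subseteq> cliques 2 V E" "(\<Sum>K\<leftarrow>Ks. card K - 1) = r"
    "\<And>x. x \<in> V \<Longrightarrow> (\<Sum>K\<leftarrow>Ks. of_bool (x \<in> K)) \<le> w x - of_bool (x \<in> K)"
    using assms(3) unfolding packs_def by blast
  have "(\<Sum>L\<leftarrow>K # Ks. of_bool (x \<in> L)) \<le> w x" if "x \<in> V" for x
    using Ks(3)[OF that] assms(2)[of x] by auto
  then show ?thesis
    unfolding packs_def using Ks(1,2) assms(1) by (intro exI[of _ "K # Ks"]) auto
qed

text \<open>Going through the cover, each clique is cut down to the vertices of positive remaining
  weight, so that it is subtracted exactly. What is left, \<open>L\<close>, contributes
  \<open>card L - 1\<close> to \<open>r\<close>; a final clique is cut further to hit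
  \<open>r\<close> exactly.\<close>

lemma packs_if_covered:
  assumes fin: "finite V"
    and Ks: "set Ks \<subseteq> {K. K \<subseteq> V \<and> clique K E}" "\<And>x. x \<in> V \<Longrightarrow> w x \<le> (\<Sum>K\<leftarrow>Ks. of_bool (x \<in> K))"
    and r: "r + length Ks \<le> sum w V"
  shows "packs V E w r"
  using Ks r
proof (induction Ks arbitrary: w r)
  case Nil
  then have "sum w V = 0" by simp
  then show ?case using Nil packs_zero by simp
next
  case (Cons K Ks)
  define L where "L = {x \<in> K. w x > 0}"
  have L: "L \<subseteq> V" "clique L E" "finite L"
    using Cons.prems(1) smaller_clique[of K E L] fin by (auto simp: L_def intro: finite_subset)
  let ?w = "\<lambda>x. w x - of_bool (x \<in> L)"
  have cov: "?w x \<le> (\<Sum>K\<leftarrow>Ks. of_bool (x \<in> K))" if "x \<in> V" for x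
    using Cons.prems(2)[OF that] by (auto simp: L_def)
  have "(\<Sum>x\<in>V. w x) = (\<Sum>x\<in>V. ?w x + of_bool (x \<in> L))"
    by (intro sum.cong) (auto simp: L_def)
  also have "\<dots> = sum ?w V + card L"
    using L(1) fin by (simp add: sum.distrib Int_absorb1)
  finally have sum_w: "sum w V = sum ?w V + card L" .
  show ?case
  proof (cases "r < card L")
    case True
    show ?thesis
    proof (cases "r = 0")
      case False
      \<comment> \<open>A subclique with \<open>Suc r\<close> vertices contributes exactly
        \<open>r\<close>, and \<open>r > 0\<close> gives it the required two vertices.\<close>
      obtain M where M: "M \<subseteq> L" "card M = Suc r"
        using obtain_subset_with_card_n[of "Suc r" L] True by auto
      have "packs V E w (card M - 1 + 0)"
        using M L False smaller_clique[OF L(2) M(1)] 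
        by (intro packs_Cons packs_zero) (auto simp: cliques_def L_def)
      then show ?thesis using M by simp
    qed (simp add: packs_zero)
  next
    case False
    show ?thesis
    proof (cases "card L \<ge> 2")
      case True
      have "packs V E ?w (r - (card L - 1))"
        using Cons.prems False True sum_w by (intro Cons.IH cov) auto
      then have "packs V E w (card L - 1 + (r - (card L - 1)))"
        using L True by (intro packs_Cons) (auto simp: cliques_def L_def)
      then show ?thesis using False by simp
    next
      case False
      \<comment> \<open>An \<open>L\<close> with at most one vertex contributes nothing, but lowers
        the total weight by at most one, which the shorter list pays for.\<close>
      have "packs V E ?w r"
        using Cons.prems False sum_w by (intro Cons.IH cov) auto
      then show ?thesis by (rule packs_mono) simp
    qed
  qed
qed

text \<open>Two vertices of a clique outside \<open>C\<close> would span an uncovered edge. So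
  \<open>C\<close> contains at least \<open>card K - 1\<close> vertices of each packed clique
  \<open>K\<close>, and summing over the packing bounds \<open>sum w C\<close> from below.\<close>

lemma cover_degree_if_packs:
  assumes "packs V E w r" and fin: "finite V" and "vertex_cover V E C"
  shows "r \<le> sum w C"
proof -
  have C: "C \<subseteq> V" "\<And>e. e \<in> E \<Longrightarrow> e \<inter> C \<noteq> {}" and finC: "finite C"
    using assms(3) fin by (auto simp: vertex_cover_def intro: finite_subset)
  obtain Ks where Ks: "set Ks \<subseteq> cliques 2 V E" "(\<Sum>K\<leftarrow>Ks. card K - 1) = r"
    "\<And>x. x \<in> V \<Longrightarrow> (\<Sum>K\<leftarrow>Ks. of_bool (x \<in> K)) \<le> w x"
    using assms(1) unfolding packs_def by blast
  have "card K - 1 \<le> card (K \<inter> C)" if "K \<in> set Ks" for K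
  proof -
    have K: "K \<subseteq> V" "clique K E" using Ks(1) that by (auto simp: cliques_def)
    have finK: "finite K" using K(1) fin finite_subset by blast
    have "x = y" if "x \<in> K - C" "y \<in> K - C" for x y
      using that K(2) C(2)[of "{x, y}"] by (auto simp: clique_def)
    then have "card (K - C) \<le> Suc 0" using finK card_le_Suc0_iff_eq[of "K - C"] by blast
    moreover have "card K = card (K \<inter> C) + card (K - C)"
      using finK by (metis card_Int_Diff)
    ultimately show ?thesis by simp
  qed
  then have "r \<le> (\<Sum>K\<leftarrow>Ks. card (K \<inter> C))"
    unfolding Ks(2)[symmetric] by (intro sum_list_mono) auto
  also have "\<dots> = (\<Sum>K\<leftarrow>Ks. \<Sum>x\<in>C. of_bool (x \<in> K))"
    using finC by (simp add: Int_commute Int_def)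
  also have "\<dots> = (\<Sum>x\<in>C. \<Sum>K\<leftarrow>Ks. of_bool (x \<in> K))"
    by (rule sum_sum_list_commute[symmetric])
  also have "\<dots> \<le> sum w C" using Ks(3) C(1) by (intro sum_mono) auto
  finally show ?thesis .
qed

lemma clique_covered_if_packs:
  assumes "packs V E w r" and fin: "finite V"
  shows "covered_by V {K. K \<subseteq> V \<and> clique K E} w (sum w V - r)"
proof -
  obtain Ks where Ks: "set Ks \<subseteq> cliques 2 V E" "(\<Sum>K\<leftarrow>Ks. card K - 1) = r"
    "\<And>x. x \<in> V \<Longrightarrow> (\<Sum>K\<leftarrow>Ks. of_bool (x \<in> K)) \<le> w x"
    using assms(1) unfolding packs_def by blast
  let ?u = "\<lambda>x. w x - (\<Sum>K\<leftarrow>Ks. of_bool (x \<in> K))"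
  have singles: "\<exists>Ls. set Ls \<subseteq> {K. K \<subseteq> V \<and> clique K E} \<and> length Ls = sum u W \<and>
      (\<forall>x\<in>W. u x \<le> (\<Sum>L\<leftarrow>Ls. of_bool (x \<in> L)))" if "W \<subseteq> V" for W and u :: "'a \<Rightarrow> nat"
    using finite_subset[OF that fin] that
  proof induction
    case (insert v W)
    then obtain Ls where Ls: "set Ls \<subseteq> {K. K \<subseteq> V \<and> clique K E}" "length Ls = sum u W"
      "\<And>x. x \<in> W \<Longrightarrow> u x \<le> (\<Sum>L\<leftarrow>Ls. of_bool (x \<in> L))" by auto
    show ?case
      using Ls insert by (intro exI[of _ "replicate (u v) {v} @ Ls"])
        (auto simp: sum_list_replicate clique_def intro: trans_le_add2)
  qed simp
  obtain Ls where Ls: "set Ls \<subseteq> {K. K \<subseteq> V \<and> clique K E}" "length Ls = sum ?u V"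
    "\<And>x. x \<in> V \<Longrightarrow> ?u x \<le> (\<Sum>L\<leftarrow>Ls. of_bool (x \<in> L))"
    using singles[of V ?u] by blast
  have card_K: "card K = (\<Sum>x\<in>V. of_bool (x \<in> K))" if "K \<in> set Ks" for K
  proof -
    have "V \<inter> K = K" using Ks(1) that by (auto simp: cliques_def)
    then show ?thesis using fin by (simp add: Int_def)
  qed
  have "length Ks + r = (\<Sum>K\<leftarrow>Ks. card K)"
  proof -
    have "(\<Sum>K\<leftarrow>Ks. card K) = (\<Sum>K\<leftarrow>Ks. 1 + (card K - 1))"
      using Ks(1) by (intro arg_cong[of _ _ sum_list] map_cong) (auto simp: cliques_def)
    also have "\<dots> = length Ks + r" by (simp only: sum_list_addf Ks(2)) (simp add: sum_list_triv)
    finally show ?thesis by simp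
  qed
  also have "\<dots> = (\<Sum>K\<leftarrow>Ks. \<Sum>x\<in>V. of_bool (x \<in> K))"
    using card_K by (intro arg_cong[of _ _ sum_list] map_cong) auto
  also have "\<dots> = (\<Sum>x\<in>V. \<Sum>K\<leftarrow>Ks. of_bool (x \<in> K))"
    by (rule sum_sum_list_commute[symmetric])
  finally have len: "length Ks + r = (\<Sum>x\<in>V. \<Sum>K\<leftarrow>Ks. of_bool (x \<in> K))" .
  have "sum w V = (\<Sum>x\<in>V. ?u x + (\<Sum>K\<leftarrow>Ks. of_bool (x \<in> K)))"
    using Ks(3) by (intro sum.cong) auto
  also have "\<dots> = length Ls + (length Ks + r)"
    unfolding sum.distrib len Ls(2) ..
  finally have "length (Ks @ Ls) \<le> sum w V - r" by simp
  moreover have "w x \<le> (\<Sum>K\<leftarrow>Ks @ Ls. of_bool (x \<in> K))" if "x \<in> V" for x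
    using Ls(3)[OF that] by simp
  moreover have "set (Ks @ Ls) \<subseteq> {K. K \<subseteq> V \<and> clique K E}"
    using Ks(1) Ls(1) by (auto simp: cliques_def)
  ultimately show ?thesis unfolding covered_by_def by blast
qed

lemma vertex_cover_complement:
  assumes "A \<subseteq> V" "indep A E" and E: "E \<subseteq> [V]\<^bsup>2\<^esup>"
  shows "vertex_cover V E (V - A)"
proof -
  have "e \<inter> (V - A) \<noteq> {}" if e: "e \<in> E" for e
  proof -
    have "e \<subseteq> V" "card e = 2" using e E by (auto simp: nsets_def)
    then obtain x y where "e = {x, y}" "x \<noteq> y" by (auto simp: card_2_iff)
    then show ?thesis using \<open>e \<subseteq> V\<close> assms(2) e by (auto simp: indep_def)
  qed
  then show ?thesis by (auto simp: vertex_cover_def)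
qed

text \<open>Vertex covers are the complements of independent sets, so a lower bound \<open>r\<close>
  on the weights of covers is the upper bound \<open>sum w V - r\<close> on the weights of
  independent sets; the same substitution turns clique covers into packings.\<close>

lemma perfect_graph_iff_packs:
  fixes V :: "'v set"
  assumes fin: "finite V" and E: "E \<subseteq> [V]\<^bsup>2\<^esup>"
  shows "perfect_graph V E \<longleftrightarrow>
    (\<forall>r\<ge>1. \<forall>w. (\<forall>C. vertex_cover V E C \<longrightarrow> r \<le> sum w C) \<longrightarrow> packs V E w r)"
proof -
  have loopless: "{v} \<notin> E" for v using E by (auto simp: nsets_def)
  let ?A = "{A. A \<subseteq> V \<and> indep A E}" and ?K = "{K. K \<subseteq> V \<and> clique K E}"
  have split: "sum w V = sum w A + sum w (V - A)" if "A \<subseteq> V" for A and w :: "'v \<Rightarrow> nat"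
    using sum.subset_diff[OF that fin, of w] by simp
  show ?thesis
    unfolding perfect_graph_iff_clique_cover[OF fin loopless]
  proof (intro iffI allI impI)
    fix r and w :: "'v \<Rightarrow> nat" assume mm: "min_max V ?K ?A" and r: "\<forall>C. vertex_cover V E C \<longrightarrow> r \<le> sum w C"
    \<comment> \<open>The whole vertex set is a cover; hence the subtraction
      \<open>sum w V - r\<close> is not truncated.\<close>
    have "r \<le> sum w V" using r vertex_cover_complement[of "{}" V E] E by simp
    have "sum w A \<le> sum w V - r" if "A \<in> ?A" for A
    proof -
      have "r \<le> sum w (V - A)" using r vertex_cover_complement[of A V E] E that by blast
      then show ?thesis using split[of A w] that by simp
    qed
    then have "covered_by V ?K w (sum w V - r)" using mm by (simp add: min_max_def)
    then obtain Ks where Ks: "set Ks \<subseteq> ?K" "length Ks \<le> sum w V - r"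
      "\<And>x. x \<in> V \<Longrightarrow> w x \<le> (\<Sum>K\<leftarrow>Ks. of_bool (x \<in> K))"
      unfolding covered_by_def by blast
    show "packs V E w r"
      using Ks \<open>r \<le> sum w V\<close> by (intro packs_if_covered[OF fin Ks(1,3)]) auto
  next
    assume packs: "\<forall>r\<ge>1. \<forall>w. (\<forall>C. vertex_cover V E C \<longrightarrow> r \<le> sum w C) \<longrightarrow> packs V E w r"
    show "min_max V ?K ?A"
      unfolding min_max_def
    proof (intro allI impI)
      fix w :: "'v \<Rightarrow> nat" and k assume k: "\<forall>A\<in>?A. sum w A \<le> k"
      \<comment> \<open>This is truncated to \<open>0\<close> when \<open>k\<close> is at least the
        total weight; then the empty packing serves, as the hypothesis covers only
        \<open>r \<ge> 1\<close>.\<close>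
      define r where "r = sum w V - k"
      have "packs V E w r"
      proof (cases "r = 0")
        case False
        have "r \<le> sum w C" if C: "vertex_cover V E C" for C
        proof -
          have "indep (V - C) E" using C by (auto simp: indep_def vertex_cover_def)
          then have "sum w (V - C) \<le> k" using k by blast
          then show ?thesis using split[of C w] C by (simp add: r_def vertex_cover_def)
        qed
        then show ?thesis using packs False by simp
      qed (simp add: packs_zero)
      from clique_covered_if_packs[OF this fin]
      have "covered_by V ?K w (sum w V - r)" .
      moreover have "sum w V - r \<le> k" by (simp add: r_def)
      ultimately show "covered_by V ?K w k"
        unfolding covered_by_def by (meson le_trans)
    qed
  qed
qed

section \<open>Monomial ideals\<close>

lemma poly_ring_simps [simp]:
  "a \<otimes>\<^bsub>poly_ring n\<^esub> b = a * b" "a \<oplus>\<^bsub>poly_ring n\<^esub> b = a + b"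
  "\<one>\<^bsub>poly_ring n\<^esub> = 1" "\<zero>\<^bsub>poly_ring n\<^esub> = 0"
  by (simp_all add: poly_ring_def)

lemma carrier_poly_ring: "p \<in> carrier (poly_ring n) \<longleftrightarrow> (\<forall>m\<in>Poly_Mapping.keys p. Poly_Mapping.keys m \<subseteq> {1..n})"
  by (auto simp: poly_ring_def poly_vars_def)

lemma keys_uminus [simp]: "Poly_Mapping.keys (- p) = Poly_Mapping.keys (p :: 'a \<Rightarrow>\<^sub>0 'b::ab_group_add)"
  by (auto simp: in_keys_iff)

lemma keys_plus_nat: "Poly_Mapping.keys (a + b) = Poly_Mapping.keys a \<union> Poly_Mapping.keys (b :: 'a \<Rightarrow>\<^sub>0 nat)"
  by (auto simp: in_keys_iff lookup_add)

lemma mult_keysE: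
  assumes "m \<in> Poly_Mapping.keys (p * q)"
  obtains a b where "m = a + b" "a \<in> Poly_Mapping.keys p" "b \<in> Poly_Mapping.keys q"
  using assms keys_mult[of p q] by blast

lemma cring_poly_ring: "cring (poly_ring n :: 'k::comm_ring_1 mpoly ring)"
proof (rule cringI)
  have uminus: "- x \<in> carrier (poly_ring n)" if "x \<in> carrier (poly_ring n)" for x :: "'k mpoly"
    using that by (simp add: carrier_poly_ring)
  have plus: "x + y \<in> carrier (poly_ring n)"
    if "x \<in> carrier (poly_ring n)" "y \<in> carrier (poly_ring n)" for x y :: "'k mpoly"
    using that keys_add[of x y] unfolding carrier_poly_ring by blast
  have zero: "0 \<in> carrier (poly_ring n :: 'k mpoly ring)"
    and one: "1 \<in> carrier (poly_ring n :: 'k mpoly ring)"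
    by (simp_all add: carrier_poly_ring)
  show "abelian_group (poly_ring n :: 'k mpoly ring)"
  proof (rule abelian_groupI)
    show "\<exists>y\<in>carrier (poly_ring n). y \<oplus>\<^bsub>poly_ring n\<^esub> x = \<zero>\<^bsub>poly_ring n\<^esub>"
      if "x \<in> carrier (poly_ring n)" for x :: "'k mpoly"
      using uminus[OF that] by (intro bexI[of _ "- x"]) auto
  qed (auto simp: ac_simps zero intro: plus)
  have times: "x * y \<in> carrier (poly_ring n)"
    if "x \<in> carrier (poly_ring n)" "y \<in> carrier (poly_ring n)" for x y :: "'k mpoly"
    using that unfolding carrier_poly_ring
    by (blast elim!: mult_keysE dest!: equalityD1[OF keys_plus_nat, THEN subsetD])
  show "comm_monoid (poly_ring n :: 'k mpoly ring)"
    by (rule comm_monoidI) (auto simp: ac_simps one intro: times)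
qed (simp add: distrib_right)

lemma ring_poly_ring: "ring (poly_ring n :: 'k::comm_ring_1 mpoly ring)"
  using cring_poly_ring by (rule cring.axioms)

lemma a_inv_poly_ring:
  fixes p :: "'k::comm_ring_1 mpoly"
  assumes "p \<in> carrier (poly_ring n)"
  shows "\<ominus>\<^bsub>poly_ring n\<^esub> p = - p"
proof -
  interpret ring "poly_ring n :: 'k mpoly ring" by (rule ring_poly_ring)
  show ?thesis
    by (rule minus_equality) (use assms in \<open>simp_all add: carrier_poly_ring\<close>)
qed

text \<open>For \<open>U\<close> closed under adding exponents this is a monomial ideal; comparing
  two such ideals amounts to comparing their sets of exponents.\<close>

definition monom_ideal :: "nat \<Rightarrow> (nat \<Rightarrow>\<^sub>0 nat) set \<Rightarrow> 'k::comm_ring_1 mpoly set" where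
  "monom_ideal n U = {p \<in> carrier (poly_ring n). Poly_Mapping.keys p \<subseteq> U}"

lemma ideal_monom_ideal:
  assumes up: "\<And>m m'. m \<in> U \<Longrightarrow> m + m' \<in> U"
  shows "ideal (monom_ideal n U :: 'k::comm_ring_1 mpoly set) (poly_ring n)"
proof -
  interpret cring "poly_ring n :: 'k mpoly ring" by (rule cring_poly_ring)
  have lc: "x * a \<in> monom_ideal n U"
    if "a \<in> monom_ideal n U" "x \<in> carrier (poly_ring n)" for a x :: "'k mpoly"
  proof -
    have "x * a \<in> carrier (poly_ring n)"
      using that m_closed[of x a] by (simp add: monom_ideal_def)
    moreover have "Poly_Mapping.keys (x * a) \<subseteq> U"
    proof
      fix m assume "m \<in> Poly_Mapping.keys (x * a)"
      then obtain b c where "m = b + c" "c \<in> Poly_Mapping.keys a" by (rule mult_keysE)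
      then show "m \<in> U" using that(1) up[of c b] by (auto simp: monom_ideal_def add.commute)
    qed
    ultimately show ?thesis by (simp add: monom_ideal_def)
  qed
  show ?thesis
  proof (rule idealI)
    show "subgroup (monom_ideal n U) (add_monoid (poly_ring n :: 'k mpoly ring))"
    proof (rule add.subgroupI)
      show "(monom_ideal n U :: 'k mpoly set) \<noteq> {}"
        by (auto simp: monom_ideal_def carrier_poly_ring intro!: exI[of _ 0])
      show "\<ominus>\<^bsub>poly_ring n\<^esub> a \<in> monom_ideal n U" if "a \<in> monom_ideal n U" for a :: "'k mpoly"
        using that by (simp add: monom_ideal_def a_inv_poly_ring carrier_poly_ring)
      show "a \<oplus>\<^bsub>poly_ring n\<^esub> b \<in> monom_ideal n U"
        if "a \<in> monom_ideal n U" "b \<in> monom_ideal n U" for a b :: "'k mpoly"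
        using that keys_add[of a b] a_closed[of a b] by (auto simp: monom_ideal_def)
    qed (auto simp: monom_ideal_def)
  qed (use lc ring_poly_ring in \<open>simp_all add: mult.commute\<close>)
qed

lemma poly_eq_sum_single: "p = (\<Sum>m\<in>Poly_Mapping.keys p. Poly_Mapping.single m (Poly_Mapping.lookup p m))"
proof (rule poly_mapping_eqI)
  fix k
  show "Poly_Mapping.lookup p k = Poly_Mapping.lookup (\<Sum>m\<in>Poly_Mapping.keys p. Poly_Mapping.single m (Poly_Mapping.lookup p m)) k"
    by (auto simp: lookup_sum lookup_single when_def in_keys_iff)
qed

lemma sum_mem_ideal:
  fixes f :: "'a \<Rightarrow> 'k::comm_ring_1 mpoly"
  assumes "ideal I (poly_ring n)" and "\<And>x. x \<in> A \<Longrightarrow> f x \<in> I"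
  shows "sum f A \<in> I"
proof -
  interpret ideal I "poly_ring n :: 'k mpoly ring" by (rule assms(1))
  show ?thesis
    using assms(2)
  proof (induction A rule: infinite_finite_induct)
    case (insert x A)
    then show ?case using additive_subgroup.a_closed[OF is_additive_subgroup, of "f x" "sum f A"] by simp
  qed (use additive_subgroup.zero_closed[OF is_additive_subgroup] in simp_all)
qed

lemma mem_ideal_if_monoms:
  fixes p :: "'k::comm_ring_1 mpoly"
  assumes I: "ideal I (poly_ring n)" and p: "p \<in> carrier (poly_ring n)"
    and mon: "\<And>m. m \<in> Poly_Mapping.keys p \<Longrightarrow> Poly_Mapping.single m 1 \<in> I"
  shows "p \<in> I"
proof -
  interpret ideal I "poly_ring n :: 'k mpoly ring" by (rule I)
  have "Poly_Mapping.single m (Poly_Mapping.lookup p m) \<in> I" if "m \<in> Poly_Mapping.keys p" for m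
  proof -
    have "(Poly_Mapping.single 0 (Poly_Mapping.lookup p m) :: 'k mpoly) \<in> carrier (poly_ring n)"
      by (simp add: carrier_poly_ring)
    from I_l_closed[OF mon[OF that] this] show ?thesis by (simp add: mult_single)
  qed
  then show ?thesis
    by (subst poly_eq_sum_single) (rule sum_mem_ideal[OF I])
qed

lemma Idl_monoms:
  assumes gens: "\<And>g. g \<in> G \<Longrightarrow> Poly_Mapping.keys g \<subseteq> {1..n}"
  shows "Idl\<^bsub>poly_ring n\<^esub> ((\<lambda>g. Poly_Mapping.single g 1) ` G)
    = (monom_ideal n {g + h | g h. g \<in> G} :: 'k::comm_ring_1 mpoly set)" (is "?I = ?M")
proof
  interpret cring "poly_ring n :: 'k mpoly ring" by (rule cring_poly_ring)
  let ?S = "(\<lambda>g. Poly_Mapping.single g 1 :: 'k mpoly) ` G"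
  have S: "?S \<subseteq> carrier (poly_ring n)"
    using gens by (auto simp: carrier_poly_ring split: if_splits)
  have "ideal ?M (poly_ring n)"
    by (rule ideal_monom_ideal) (use add.assoc in blast)
  moreover have "?S \<subseteq> ?M"
    using gens by (force simp: monom_ideal_def carrier_poly_ring intro: exI[of _ 0])
  ultimately show "?I \<subseteq> ?M" by (rule genideal_minimal)
  interpret I: ideal ?I "poly_ring n :: 'k mpoly ring" by (rule genideal_ideal[OF S])
  show "?M \<subseteq> ?I"
  proof
    fix p :: "'k mpoly" assume p: "p \<in> ?M"
    show "p \<in> ?I"
    proof (rule mem_ideal_if_monoms[OF I.ideal_axioms])
      show "p \<in> carrier (poly_ring n)" using p by (simp add: monom_ideal_def)
      fix m assume m: "m \<in> Poly_Mapping.keys p"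
      then obtain g h where gh: "m = g + h" "g \<in> G"
        using p by (auto simp: monom_ideal_def)
      have "Poly_Mapping.keys m \<subseteq> {1..n}" using p m by (auto simp: monom_ideal_def carrier_poly_ring)
      \<comment> \<open>Natural exponents cannot cancel, so the cofactor involves only variables of
        \<open>m\<close>.\<close>
      then have "(Poly_Mapping.single h 1 :: 'k mpoly) \<in> carrier (poly_ring n)"
        by (simp add: gh carrier_poly_ring keys_plus_nat)
      moreover have "Poly_Mapping.single g 1 \<in> ?I"
        using genideal_self[OF S] gh by blast
      ultimately show "Poly_Mapping.single m 1 \<in> ?I"
        using I.I_r_closed[of "Poly_Mapping.single g 1" "Poly_Mapping.single h 1"]
        by (simp add: mult_single gh)
    qed
  qed
qed

lemma monom_ideal_eq_iff:
  "monom_ideal n U = (monom_ideal n U' :: 'k::comm_ring_1 mpoly set) \<longleftrightarrow>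
     (\<forall>m. Poly_Mapping.keys m \<subseteq> {1..n} \<longrightarrow> (m \<in> U \<longleftrightarrow> m \<in> U'))" (is "?L \<longleftrightarrow> ?R")
proof
  assume ?L
  show ?R
  proof (intro allI impI)
    fix m :: "nat \<Rightarrow>\<^sub>0 nat" assume "Poly_Mapping.keys m \<subseteq> {1..n}"
    then have "(Poly_Mapping.single m 1 :: 'k mpoly) \<in> monom_ideal n W \<longleftrightarrow> m \<in> W" for W
      by (simp add: monom_ideal_def carrier_poly_ring)
    with \<open>?L\<close> show "m \<in> U \<longleftrightarrow> m \<in> U'" by blast
  qed
next
  assume ?R
  then show ?L by (fastforce simp: monom_ideal_def carrier_poly_ring)
qed

section \<open>Degrees of monomials along a set of variables\<close>

definition cdeg :: "nat set \<Rightarrow> (nat \<Rightarrow>\<^sub>0 nat) \<Rightarrow> nat" where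
  "cdeg C m = (\<Sum>i\<in>C. Poly_Mapping.lookup m i)"

lemma cdeg_add [simp]: "cdeg C (a + b) = cdeg C a + cdeg C b"
  by (simp add: cdeg_def lookup_add sum.distrib)

lemma cdeg_zero [simp]: "cdeg C 0 = 0"
  by (simp add: cdeg_def)

lemma cdeg_single: "finite C \<Longrightarrow> cdeg C (Poly_Mapping.single i c) = (if i \<in> C then c else 0)"
  by (auto simp: cdeg_def lookup_single when_def)

text \<open>A single coefficient of a product depends only on the pairs of exponents adding up to
  \<open>m\<close>. This allows replacing both factors by their components of one degree.\<close>

lemma lookup_mult_cong:
  fixes f :: "'k::comm_ring_1 mpoly"
  assumes "\<And>a b. m = a + b \<Longrightarrow> Poly_Mapping.lookup f a * Poly_Mapping.lookup g b = Poly_Mapping.lookup f' a * Poly_Mapping.lookup g' b"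
  shows "Poly_Mapping.lookup (f * g) m = Poly_Mapping.lookup (f' * g') m"
proof -
  have *: "Poly_Mapping.lookup p a * Sum_any (\<lambda>q. Poly_Mapping.lookup q' q when m = a + q) = (Poly_Mapping.lookup p a * Poly_Mapping.lookup q' (m - a) when m = a + (m - a))"
    for p q' :: "'k mpoly" and a
  proof -
    \<comment> \<open>The inner sum has at most the term \<open>q = m - a\<close>; since this
      difference is truncated, the condition \<open>m = a + (m - a)\<close> has to be kept.\<close>
    have eq: "m = a + q \<longleftrightarrow> m = a + (m - a) \<and> q = m - a" for q by (metis add_diff_cancel_left')
    have "Sum_any (\<lambda>q. Poly_Mapping.lookup q' q when m = a + q) =
        Sum_any (\<lambda>q. (Poly_Mapping.lookup q' q when m = a + (m - a)) when q = m - a)"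
      by (rule Sum_any.cong) (simp only: when_when flip: eq)
    then show ?thesis by (simp add: mult_when)
  qed
  show ?thesis
    unfolding lookup_mult * by (rule Sum_any.cong, rule when_cong[OF refl], rule assms)
qed

text \<open>The components of lowest \<open>C\<close>-degree of two polynomials have a nonzero product.\<close>

lemma cdeg_mult_ge_imp:
  fixes f s :: "'k::idom mpoly"
  assumes fs: "\<And>m. m \<in> Poly_Mapping.keys (f * s) \<Longrightarrow> r \<le> cdeg C m"
    and s: "m0 \<in> Poly_Mapping.keys s" "cdeg C m0 = 0" and m: "m \<in> Poly_Mapping.keys f"
  shows "r \<le> cdeg C m"
proof (rule ccontr)
  assume "\<not> r \<le> cdeg C m"
  define d where "d = Min (cdeg C ` Poly_Mapping.keys f)"
  have d_le: "d \<le> cdeg C a" if "a \<in> Poly_Mapping.keys f" for a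
    using that by (simp add: d_def)
  have "d \<in> cdeg C ` Poly_Mapping.keys f"
    unfolding d_def using m by (intro Min_in) auto
  then obtain m1 where m1: "m1 \<in> Poly_Mapping.keys f" "cdeg C m1 = d" by auto
  have "d < r" using d_le[OF m] \<open>\<not> r \<le> cdeg C m\<close> by simp
  define f' where "f' = Poly_Mapping.mapp (\<lambda>a v. v when cdeg C a = d) f"
  define s' where "s' = Poly_Mapping.mapp (\<lambda>a v. v when cdeg C a = 0) s"
  have lf: "Poly_Mapping.lookup f' a = (Poly_Mapping.lookup f a when cdeg C a = d)" for a
    by (auto simp: f'_def lookup_mapp when_def in_keys_iff)
  have ls: "Poly_Mapping.lookup s' a = (Poly_Mapping.lookup s a when cdeg C a = 0)" for a
    by (auto simp: s'_def lookup_mapp when_def in_keys_iff)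
  have "m1 \<in> Poly_Mapping.keys f'" "m0 \<in> Poly_Mapping.keys s'"
    using m1 s by (auto simp: in_keys_iff lf ls)
  then have "f' * s' \<noteq> 0" by auto
  then obtain k where k: "k \<in> Poly_Mapping.keys (f' * s')" by (metis all_not_in_conv keys_eq_empty)
  then obtain a b where ab: "k = a + b" "a \<in> Poly_Mapping.keys f'" "b \<in> Poly_Mapping.keys s'" by (rule mult_keysE)
  then have "cdeg C k = d" by (auto simp: in_keys_iff lf ls)
  \<comment> \<open>As \<open>k\<close> has degree \<open>d\<close> and no exponent of
    \<open>f\<close> has smaller degree, a contributing pair must have degrees \<open>d\<close> and
    \<open>0\<close>.\<close>
  have "Poly_Mapping.lookup (f * s) k = Poly_Mapping.lookup (f' * s') k"
  proof (rule lookup_mult_cong)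
    fix a b assume "k = a + b"
    then have "d = cdeg C a + cdeg C b" using \<open>cdeg C k = d\<close> by simp
    then show "Poly_Mapping.lookup f a * Poly_Mapping.lookup s b = Poly_Mapping.lookup f' a * Poly_Mapping.lookup s' b"
      by (cases "Poly_Mapping.lookup f a = 0")
        (use d_le[of a] in \<open>auto simp: lf ls when_def in_keys_iff\<close>)
  qed
  then have "k \<in> Poly_Mapping.keys (f * s)" using k by (simp add: in_keys_iff)
  from fs[OF this] show False using \<open>cdeg C k = d\<close> \<open>d < r\<close> by simp
qed

section \<open>Symbolic powers of edge ideals\<close>

text \<open>For \<open>C \<subseteq> {1..n}\<close> this is the \<open>r\<close>-th power of the
  prime generated by the variables in \<open>C\<close>, described by its monomials.\<close>

definition cover_ideal :: "nat \<Rightarrow> nat \<Rightarrow> nat set \<Rightarrow> 'k::comm_ring_1 mpoly set" where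
  "cover_ideal n r C = monom_ideal n {m. r \<le> cdeg C m}"

lemma mem_cover_ideal:
  "p \<in> cover_ideal n r C \<longleftrightarrow>
     p \<in> carrier (poly_ring n) \<and> (\<forall>m\<in>Poly_Mapping.keys p. r \<le> cdeg C m)"
  by (auto simp: cover_ideal_def monom_ideal_def)

lemma ideal_cover_ideal: "ideal (cover_ideal n r C) (poly_ring n)"
  unfolding cover_ideal_def by (rule ideal_monom_ideal) simp

text \<open>A factor outside the ideal has a monomial of degree \<open>0\<close>, so by the
  lowest-degree argument the other factor inherits the bound \<open>1\<close> from the
  product.\<close>

lemma primeideal_cover_ideal:
  "primeideal (cover_ideal n 1 C :: 'k::idom mpoly set) (poly_ring n)"
proof (rule primeidealI[OF ideal_cover_ideal cring_poly_ring])
  have "1 \<in> carrier (poly_ring n)" "1 \<notin> (cover_ideal n 1 C :: 'k mpoly set)"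
    by (simp_all add: mem_cover_ideal carrier_poly_ring)
  then show "carrier (poly_ring n) \<noteq> (cover_ideal n 1 C :: 'k mpoly set)" by blast
  fix a b :: "'k mpoly"
  assume ab: "a \<in> carrier (poly_ring n)" "b \<in> carrier (poly_ring n)"
    "a \<otimes>\<^bsub>poly_ring n\<^esub> b \<in> cover_ideal n 1 C"
  show "a \<in> cover_ideal n 1 C \<or> b \<in> cover_ideal n 1 C"
  proof (rule disjCI)
    assume "b \<notin> cover_ideal n 1 C"
    then obtain m0 where m0: "m0 \<in> Poly_Mapping.keys b" "cdeg C m0 = 0"
      using ab(2) by (auto simp: mem_cover_ideal not_le)
    have "1 \<le> cdeg C m" if "m \<in> Poly_Mapping.keys (a * b)" for m
      using ab(3) that by (simp add: mem_cover_ideal)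
    then have "1 \<le> cdeg C m" if "m \<in> Poly_Mapping.keys a" for m
      using m0 that by (rule cdeg_mult_ge_imp)
    then show "a \<in> cover_ideal n 1 C" using ab(1) by (simp add: mem_cover_ideal)
  qed
qed

lemma ideal_pow:
  assumes "ring R" "ideal I R"
  shows "ideal (I [^]\<^bsub>ideals_set R\<^esub> (r::nat)) R"
proof (induction r)
  case 0
  then show ?case using ring.oneideal[OF assms(1)] by (simp add: ideals_set_def)
next
  case (Suc r)
  then show ?case
    using ring.ideal_prod_is_ideal[OF assms(1) _ assms(2)] by (simp add: ideals_set_def)
qed

lemma mult_mem_pow_Suc:
  assumes "a \<in> I [^]\<^bsub>ideals_set R\<^esub> (r::nat)" "b \<in> I"
  shows "a \<otimes>\<^bsub>R\<^esub> b \<in> I [^]\<^bsub>ideals_set R\<^esub> Suc r"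
  using ideal_prod.prod[OF assms] by (simp add: ideals_set_def)

lemma pow_subset_cover_ideal:
  fixes I :: "'k::comm_ring_1 mpoly set"
  assumes "I \<subseteq> cover_ideal n 1 C"
  shows "I [^]\<^bsub>ideals_set (poly_ring n)\<^esub> (r::nat) \<subseteq> cover_ideal n r C"
proof (induction r)
  case 0
  then show ?case by (auto simp: ideals_set_def mem_cover_ideal)
next
  case (Suc r)
  interpret cring "poly_ring n :: 'k mpoly ring" by (rule cring_poly_ring)
  interpret J: ideal "cover_ideal n (Suc r) C" "poly_ring n :: 'k mpoly ring"
    by (rule ideal_cover_ideal)
  show ?case
  proof
    fix p assume "p \<in> I [^]\<^bsub>ideals_set (poly_ring n)\<^esub> Suc r"
    then have "p \<in> ideal_prod (poly_ring n) (I [^]\<^bsub>ideals_set (poly_ring n)\<^esub> r) I"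
      by (simp add: ideals_set_def)
    then show "p \<in> cover_ideal n (Suc r) C"
    proof induction
      case (prod i j)
      then have i: "i \<in> cover_ideal n r C" and j: "j \<in> cover_ideal n 1 C"
        using Suc assms by auto
      then have "i * j \<in> carrier (poly_ring n)"
        using m_closed[of i j] by (simp add: mem_cover_ideal)
      moreover have "Suc r \<le> cdeg C m" if "m \<in> Poly_Mapping.keys (i * j)" for m
        using that
      proof (rule mult_keysE)
        fix a b assume "m = a + b" "a \<in> Poly_Mapping.keys i" "b \<in> Poly_Mapping.keys j"
        then show ?thesis using i j unfolding mem_cover_ideal by fastforce
      qed
      ultimately show ?case by (simp add: mem_cover_ideal)
    next
      case (sum s1 s2)
      then show ?case using J.a_closed by blast
    qed
  qed
qed

section \<open>Minimal primes of the edge ideal and localization at them\<close>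

locale graph_ideal =
  fixes n :: nat and E :: "nat set set" and I :: "'k::idom mpoly set"
  assumes edges: "E \<subseteq> [{1..n}]\<^bsup>2\<^esup>"
  defines "I \<equiv> edge_ideal n E"
begin

lemma edgeD:
  assumes "{i, j} \<in> E"
  shows "i \<in> {1..n}" "j \<in> {1..n}" "i \<noteq> j"
proof -
  have "{i, j} \<in> [{1..n}]\<^bsup>2\<^esup>" using assms edges by blast
  then show "i \<in> {1..n}" "j \<in> {1..n}" "i \<noteq> j" by (auto simp: nsets_def)
qed

lemma edgeE:
  assumes "e \<in> E"
  obtains i j where "e = {i, j}" "i \<noteq> j"
proof -
  have "card e = 2" using assms edges by (auto simp: nsets_def)
  then show thesis using that by (auto simp: card_2_iff)
qed

lemma var_mem_carrier: "i \<in> {1..n} \<Longrightarrow> var i \<in> carrier (poly_ring n :: 'k mpoly ring)"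
  by (simp add: var_def carrier_poly_ring)

lemma edges_carrier: "{var i * var j | i j. {i, j} \<in> E} \<subseteq> carrier (poly_ring n :: 'k mpoly ring)"
  using edgeD by (force simp: var_def mult_single carrier_poly_ring keys_plus_nat)

lemma ideal_I: "ideal I (poly_ring n)"
  unfolding I_def edge_ideal_def by (rule ring.genideal_ideal[OF ring_poly_ring edges_carrier])

lemma edge_mem_I:
  assumes "{i, j} \<in> E"
  shows "Poly_Mapping.single (Poly_Mapping.single i 1 + Poly_Mapping.single j 1) 1 \<in> I"
proof -
  have "var i * var j \<in> I"
    unfolding I_def edge_ideal_def
    using ring.genideal_self[OF ring_poly_ring edges_carrier] assms by blast
  then show ?thesis by (simp add: var_def mult_single)
qed

lemma vertex_cover_finite: "vertex_cover {1..n} E C \<Longrightarrow> finite C"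
  by (auto simp: vertex_cover_def intro: finite_subset)

lemma I_subset_cover_ideal:
  assumes C: "vertex_cover {1..n} E C"
  shows "I \<subseteq> cover_ideal n 1 C"
proof -
  have "var i * var j \<in> (cover_ideal n 1 C :: 'k mpoly set)" if e: "{i, j} \<in> E" for i j
  proof -
    have "var i * var j \<in> carrier (poly_ring n :: 'k mpoly ring)"
      using edges_carrier e by blast
    moreover have "i \<in> C \<or> j \<in> C" using C e by (auto simp: vertex_cover_def)
    ultimately show ?thesis
      using vertex_cover_finite[OF C]
      by (auto simp: mem_cover_ideal var_def mult_single cdeg_single)
  qed
  then show ?thesis
    unfolding I_def edge_ideal_def
    by (intro ring.genideal_minimal[OF ring_poly_ring ideal_cover_ideal]) blast
qed

lemma var_mem_cover_ideal:
  "finite C \<Longrightarrow> i \<in> {1..n} \<Longrightarrow> (var i :: 'k mpoly) \<in> cover_ideal n 1 C \<longleftrightarrow> i \<in> C"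
  using var_mem_carrier by (auto simp: mem_cover_ideal var_def cdeg_single)

lemma vertex_cover_of_prime:
  assumes "primeideal P (poly_ring n)" "I \<subseteq> P"
  shows "vertex_cover {1..n} E {i \<in> {1..n}. var i \<in> P}"
proof -
  interpret primeideal P "poly_ring n :: 'k mpoly ring" by (rule assms(1))
  have "e \<inter> {i \<in> {1..n}. var i \<in> P} \<noteq> {}" if e: "e \<in> E" for e
  proof -
    obtain i j where ij: "e = {i, j}" using e by (rule edgeE)
    have "var i * var j \<in> P"
      using edge_mem_I[of i j] e ij assms(2) by (auto simp: var_def mult_single)
    then have "var i \<in> P \<or> var j \<in> P"
      using I_prime[of "var i" "var j"] edgeD[of i j] e ij by (simp add: var_mem_carrier)
    then show ?thesis using edgeD[of i j] e ij by auto
  qed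
  then show ?thesis by (auto simp: vertex_cover_def)
qed

text \<open>A monomial of positive \<open>C\<close>-degree is divisible by some variable in
  \<open>C\<close>.\<close>

lemma cover_ideal_subset:
  assumes "ideal P (poly_ring n)" and C: "finite C" "\<And>i. i \<in> C \<Longrightarrow> var i \<in> P"
  shows "(cover_ideal n 1 C :: 'k mpoly set) \<subseteq> P"
proof
  fix p :: "'k mpoly" assume p: "p \<in> cover_ideal n 1 C"
  interpret ideal P "poly_ring n :: 'k mpoly ring" by (rule assms(1))
  show "p \<in> P"
  proof (rule mem_ideal_if_monoms[OF assms(1)])
    show "p \<in> carrier (poly_ring n)" using p by (simp add: mem_cover_ideal)
    fix m assume m: "m \<in> Poly_Mapping.keys p"
    then have "cdeg C m > 0" using p by (auto simp: mem_cover_ideal)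
    then obtain i where i: "i \<in> C" "Poly_Mapping.lookup m i > 0"
      unfolding cdeg_def by (metis gr_zeroI less_irrefl sum.neutral)
    define h where "h = m - Poly_Mapping.single i 1"
    have mh: "m = Poly_Mapping.single i 1 + h"
      using i by (intro poly_mapping_eqI) (auto simp: h_def lookup_add lookup_minus lookup_single when_def)
    have "Poly_Mapping.keys m \<subseteq> {1..n}" using p m by (auto simp: mem_cover_ideal carrier_poly_ring)
    then have "Poly_Mapping.single h 1 \<in> carrier (poly_ring n :: 'k mpoly ring)"
      by (simp add: mh carrier_poly_ring keys_plus_nat)
    from I_r_closed[OF C(2)[OF i(1)] this] show "Poly_Mapping.single m 1 \<in> P"
      by (simp add: var_def mult_single mh)
  qed
qed

text \<open>A prime over \<open>I\<close> contains a variable of every edge, hence the ideal of a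
  minimal cover. Since \<open>C\<close> is recovered from its ideal as the set of variables in it,
  minimality of covers and of primes correspond.\<close>

lemma minimal_primes_eq:
  "minimal_primes (poly_ring n) I = cover_ideal n 1 ` {C. minimal_vertex_cover {1..n} E C}"
proof (intro equalityI subsetI)
  fix P assume P: "P \<in> minimal_primes (poly_ring n) I"
  then have prime: "primeideal P (poly_ring n)" and IP: "I \<subseteq> P"
    and min: "\<And>Q. primeideal Q (poly_ring n) \<Longrightarrow> I \<subseteq> Q \<Longrightarrow> Q \<subseteq> P \<Longrightarrow> Q = P"
    by (auto simp: minimal_primes_def)
  obtain C where C: "minimal_vertex_cover {1..n} E C" "C \<subseteq> {i \<in> {1..n}. var i \<in> P}"
    using vertex_cover_of_prime[OF prime IP] by (rule obtain_minimal_vertex_cover[rotated]) auto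
  then have vc: "vertex_cover {1..n} E C" by (simp add: minimal_vertex_cover_def)
  have "cover_ideal n 1 C \<subseteq> P"
    using C(2) by (intro cover_ideal_subset primeideal.axioms(1)[OF prime] vertex_cover_finite[OF vc]) auto
  then have "cover_ideal n 1 C = P"
    by (intro min primeideal_cover_ideal I_subset_cover_ideal[OF vc])
  then show "P \<in> cover_ideal n 1 ` {C. minimal_vertex_cover {1..n} E C}" using C(1) by blast
next
  fix P :: "'k mpoly set" assume "P \<in> cover_ideal n 1 ` {C. minimal_vertex_cover {1..n} E C}"
  then obtain C where C: "minimal_vertex_cover {1..n} E C" and P: "P = cover_ideal n 1 C" by blast
  then have vc: "vertex_cover {1..n} E C" by (simp add: minimal_vertex_cover_def)
  have "Q = P" if Q: "primeideal Q (poly_ring n)" "I \<subseteq> Q" "Q \<subseteq> P" for Q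
  proof -
    have "{i \<in> {1..n}. var i \<in> Q} \<subseteq> C"
      using Q(3) var_mem_cover_ideal[OF vertex_cover_finite[OF vc]] by (auto simp: P)
    then have "{i \<in> {1..n}. var i \<in> Q} = C"
      using C vertex_cover_of_prime[OF Q(1,2)] by (simp add: minimal_vertex_cover_def)
    then have "P \<subseteq> Q"
      unfolding P by (intro cover_ideal_subset primeideal.axioms(1)[OF Q(1)] vertex_cover_finite[OF vc]) auto
    then show ?thesis using Q(3) by blast
  qed
  then show "P \<in> minimal_primes (poly_ring n) I"
    unfolding minimal_primes_def
    using primeideal_cover_ideal[of n C] I_subset_cover_ideal[OF vc] by (simp add: P)
qed

text \<open>Minimality gives every vertex of \<open>C\<close> a neighbour outside \<open>C\<close>.
  Each of \<open>r\<close> units of \<open>C\<close>-degree in \<open>m\<close> is paired with such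
  a neighbour to form an edge. All these edges may end in the same vertex, so the multiplier holds
  each outside variable to the power \<open>r\<close>.\<close>

lemma monom_mem_pow:
  assumes C: "minimal_vertex_cover {1..n} E C"
    and "r \<le> cdeg C m" "Poly_Mapping.keys m \<subseteq> {1..n}"
  shows "Poly_Mapping.single (m + (\<Sum>j\<in>{1..n} - C. Poly_Mapping.single j r)) 1
    \<in> I [^]\<^bsub>ideals_set (poly_ring n)\<^esub> r"
  using assms(2,3)
proof (induction r arbitrary: m)
  case 0
  then show ?case by (simp add: ideals_set_def carrier_poly_ring)
next
  case (Suc r)
  let ?D = "{1..n} - C"
  have vc: "vertex_cover {1..n} E C" using C by (simp add: minimal_vertex_cover_def)
  have fin: "finite C" using vc by (rule vertex_cover_finite)
  obtain i where i: "i \<in> C" "Poly_Mapping.lookup m i > 0"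
    using Suc.prems(1) unfolding cdeg_def by (metis gr_zeroI not_less_eq_eq sum.neutral zero_le)
  define h where "h = m - Poly_Mapping.single i 1"
  have mh: "m = h + Poly_Mapping.single i 1"
    using i by (intro poly_mapping_eqI) (auto simp: h_def lookup_add lookup_minus lookup_single when_def)
  \<comment> \<open>Since \<open>C - {i}\<close> is no cover, some edge meets \<open>C\<close> only
    in \<open>i\<close>; its other end \<open>j\<close> lies outside \<open>C\<close>.\<close>
  have "\<not> vertex_cover {1..n} E (C - {i})"
    using C i by (auto simp: minimal_vertex_cover_def)
  then obtain e where e: "e \<in> E" "e \<inter> (C - {i}) = {}"
    using vc by (auto simp: vertex_cover_def)
  have "e \<inter> C \<noteq> {}" using vc e by (auto simp: vertex_cover_def)
  then have ie: "i \<in> e" using e by auto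
  obtain j where j: "e = {i, j}" "i \<noteq> j" using edgeE[OF e(1)] ie by (metis insertE insert_commute singletonD)
  have jD: "j \<in> ?D" using j e edgeD[of i j] by auto
  have IH: "Poly_Mapping.single (h + (\<Sum>j\<in>?D. Poly_Mapping.single j r)) 1
      \<in> I [^]\<^bsub>ideals_set (poly_ring n)\<^esub> r"
    using Suc.prems i fin by (intro Suc.IH) (auto simp: mh keys_plus_nat cdeg_single)
  have edge: "Poly_Mapping.single (Poly_Mapping.single i 1 + Poly_Mapping.single j 1) 1 \<in> I"
    using edge_mem_I[of i j] e j by simp
  have rest: "Poly_Mapping.single (\<Sum>j\<in>?D - {j}. Poly_Mapping.single j 1) 1
      \<in> carrier (poly_ring n :: 'k mpoly ring)"
    by (auto simp: carrier_poly_ring in_keys_iff lookup_sum lookup_single when_def split: if_splits)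
  \<comment> \<open>Of the additional outside variables, \<open>j\<close> is spent on the edge and
    the others remain as a cofactor in the ring.\<close>
  have split: "(\<Sum>j\<in>?D. Poly_Mapping.single j (Suc r)) = (\<Sum>j\<in>?D. Poly_Mapping.single j r)
      + (Poly_Mapping.single j 1 + (\<Sum>j\<in>?D - {j}. Poly_Mapping.single j 1))"
  proof -
    have "(\<Sum>j\<in>?D. Poly_Mapping.single j (Suc r)) =
        (\<Sum>j\<in>?D. Poly_Mapping.single j r) + (\<Sum>j\<in>?D. Poly_Mapping.single j 1)"
      by (simp add: sum.distrib[symmetric] single_add[symmetric])
    also have "(\<Sum>j\<in>?D. Poly_Mapping.single j (1::nat)) =
        Poly_Mapping.single j 1 + (\<Sum>j\<in>?D - {j}. Poly_Mapping.single j 1)"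
      using jD by (intro sum.remove) auto
    finally show ?thesis .
  qed
  interpret J: ideal "I [^]\<^bsub>ideals_set (poly_ring n)\<^esub> Suc r" "poly_ring n :: 'k mpoly ring"
    by (rule ideal_pow[OF ring_poly_ring ideal_I])
  have "Poly_Mapping.single (m + (\<Sum>j\<in>?D. Poly_Mapping.single j (Suc r))) (1::'k) =
      (Poly_Mapping.single (h + (\<Sum>j\<in>?D. Poly_Mapping.single j r)) 1 *
       Poly_Mapping.single (Poly_Mapping.single i 1 + Poly_Mapping.single j 1) 1) *
      Poly_Mapping.single (\<Sum>j\<in>?D - {j}. Poly_Mapping.single j 1) 1"
    unfolding split mult_single by (simp add: mh ac_simps)
  also have "\<dots> \<in> I [^]\<^bsub>ideals_set (poly_ring n)\<^esub> Suc r"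
    using J.I_r_closed[OF mult_mem_pow_Suc[OF IH edge] rest] by (simp del: nat_pow_Suc)
  finally show ?case .
qed

text \<open>
  For the inclusion from right to left, \<open>f\<close> is multiplied by the sum over all minimal vertex
  covers \<open>C\<close> of the monomials \<open>(\<Prod>j\<notin>C. x\<^sub>j)\<^bsup>r\<^esup>\<close>, which lies in no minimal prime.
\<close>

lemma symbolic_power_eq:
  assumes r: "r \<ge> 1"
  shows "symbolic_power (poly_ring n) I r =
    {f \<in> carrier (poly_ring n). \<forall>m\<in>Poly_Mapping.keys f. \<forall>C. minimal_vertex_cover {1..n} E C \<longrightarrow> r \<le> cdeg C m}"
    (is "_ = ?M")
proof -
  let ?R = "poly_ring n :: 'k mpoly ring"
  let ?S = "carrier ?R - \<Union> (minimal_primes ?R I)"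
  let ?MC = "{C. minimal_vertex_cover {1..n} E C}"
  interpret cring ?R by (rule cring_poly_ring)
  \<comment> \<open>A minimal cover yields a minimal prime; it contains \<open>0\<close>, which
    keeps \<open>0\<close> out of the denominators.\<close>
  have "vertex_cover {1..n} E {1..n}"
    unfolding vertex_cover_def using edgeE edgeD by (metis Int_insert_left_if1 insert_not_empty order_refl)
  then obtain C0 where C0: "minimal_vertex_cover {1..n} E C0"
    using obtain_minimal_vertex_cover[of "{1..n}" E] by blast
  have S: "s \<in> ?S \<longleftrightarrow> s \<in> carrier ?R \<and> (\<forall>C\<in>?MC. s \<notin> cover_ideal n 1 C)" for s
    by (auto simp: minimal_primes_eq)
  have S0: "0 \<notin> ?S"
    using C0 S by (auto simp: mem_cover_ideal)
  \<comment> \<open>Cross-multiplication in the fraction field turns membership in the localization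
    into a statement about ring elements.\<close>
  have sym: "f \<in> symbolic_power ?R I r \<longleftrightarrow>
      f \<in> carrier ?R \<and> (\<exists>s\<in>?S. f * s \<in> I [^]\<^bsub>ideals_set ?R\<^esub> r)" for f
  proof -
    have eq: "Fraction_Field.Fract f 1 = Fraction_Field.Fract a s \<longleftrightarrow> f * s = a" if "s \<in> ?S" for a s
    proof -
      have "s \<noteq> 0" using S0 that by metis
      then show ?thesis by (simp add: eq_fract)
    qed
    have "Fraction_Field.Fract f 1 \<in> localize ?S J \<longleftrightarrow> (\<exists>s\<in>?S. f * s \<in> J)" for J
    proof
      assume "Fraction_Field.Fract f 1 \<in> localize ?S J"
      then obtain a s where as: "Fraction_Field.Fract f 1 = Fraction_Field.Fract a s" "a \<in> J" "s \<in> ?S"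
        unfolding localize_def by blast
      then have "f * s = a" using eq[OF as(3)] by blast
      then show "\<exists>s\<in>?S. f * s \<in> J" using as(2,3) by blast
    next
      assume "\<exists>s\<in>?S. f * s \<in> J"
      then obtain s where s: "s \<in> ?S" "f * s \<in> J" by blast
      then have "Fraction_Field.Fract f 1 = Fraction_Field.Fract (f * s) s"
        using eq[OF s(1)] by blast
      then show "Fraction_Field.Fract f 1 \<in> localize ?S J"
        unfolding localize_def using s by blast
    qed
    then show ?thesis by (simp add: symbolic_power_def)
  qed
  show ?thesis
  proof (intro equalityI subsetI)
    fix f assume "f \<in> symbolic_power ?R I r"
    then obtain s where f: "f \<in> carrier ?R" and s: "s \<in> ?S" and fs: "f * s \<in> I [^]\<^bsub>ideals_set ?R\<^esub> r"
      using sym by blast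
    have "r \<le> cdeg C m" if m: "m \<in> Poly_Mapping.keys f" and C: "minimal_vertex_cover {1..n} E C" for m C
    proof -
      have "s \<notin> cover_ideal n 1 C" "s \<in> carrier ?R" using s S C by auto
      \<comment> \<open>Lying outside the prime of \<open>C\<close>, the denominator has a monomial
        free of the variables in \<open>C\<close>.\<close>
      then obtain m0 where m0: "m0 \<in> Poly_Mapping.keys s" "cdeg C m0 = 0"
        by (auto simp: mem_cover_ideal not_le)
      have "vertex_cover {1..n} E C" using C by (simp add: minimal_vertex_cover_def)
      from pow_subset_cover_ideal[OF I_subset_cover_ideal[OF this], of r]
      have "f * s \<in> cover_ideal n r C" using fs by blast
      then have "r \<le> cdeg C k" if "k \<in> Poly_Mapping.keys (f * s)" for k
        using that by (simp add: mem_cover_ideal)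
      then show ?thesis using m0 m by (rule cdeg_mult_ge_imp)
    qed
    then show "f \<in> ?M" using f by blast
  next
    fix f assume f: "f \<in> ?M"
    define t where "t C = (\<Sum>j\<in>{1..n} - C. Poly_Mapping.single j r)" for C
    define s :: "'k mpoly" where "s = (\<Sum>C\<in>?MC. Poly_Mapping.single (t C) 1)"
    have MC: "C \<subseteq> {1..n}" if "C \<in> ?MC" for C
      using that by (simp add: minimal_vertex_cover_def vertex_cover_def)
    have fin: "finite ?MC"
      using MC by (intro finite_subset[of ?MC "Pow {1..n}"]) auto
    have lookup_t: "Poly_Mapping.lookup (t C) j = (if j \<in> {1..n} - C then r else 0)" for C j
      by (simp add: t_def lookup_sum lookup_single when_def)
    \<comment> \<open>Because \<open>r \<ge> 1\<close>, different covers give different monomials.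
      So each coefficient in \<open>s\<close> is \<open>1\<close>, and no summands can cancel in
      positive characteristic.\<close>
    have t_inj: "C = D" if CD: "C \<in> ?MC" "D \<in> ?MC" and eq: "t C = t D" for C D
    proof -
      have "j \<in> {1..n} - C \<longleftrightarrow> j \<in> {1..n} - D" for j
        using lookup_t[of C j] lookup_t[of D j] eq r by (auto split: if_splits)
      then show ?thesis using MC[OF CD(1)] MC[OF CD(2)] by blast
    qed
    have lookup_s: "Poly_Mapping.lookup s (t C) = 1" if C: "C \<in> ?MC" for C
    proof -
      have "Poly_Mapping.lookup s (t C) = (\<Sum>D\<in>?MC. if D = C then 1 else 0)"
        unfolding s_def lookup_sum using t_inj C
        by (intro sum.cong) (auto simp: lookup_single when_def)
      then show ?thesis using fin C by simp
    qed
    have t_carrier: "Poly_Mapping.single (t C) 1 \<in> carrier ?R" for C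
      using lookup_t by (auto simp: carrier_poly_ring in_keys_iff split: if_splits)
    have "s \<in> carrier ?R"
      unfolding s_def by (intro sum_mem_ideal[OF oneideal] t_carrier)
    moreover have "s \<notin> cover_ideal n 1 C" if C: "C \<in> ?MC" for C
    proof -
      have "t C \<in> Poly_Mapping.keys s" using lookup_s[OF C] by (simp add: in_keys_iff)
      moreover have "cdeg C (t C) = 0" by (auto simp: cdeg_def lookup_t)
      ultimately show ?thesis by (force simp: mem_cover_ideal)
    qed
    ultimately have "s \<in> ?S" using S by blast
    moreover have "f * s \<in> I [^]\<^bsub>ideals_set ?R\<^esub> r"
    proof -
      have pow: "ideal (I [^]\<^bsub>ideals_set ?R\<^esub> r) ?R"
        by (rule ideal_pow[OF ring_poly_ring ideal_I])
      have "f * Poly_Mapping.single (t C) 1 \<in> I [^]\<^bsub>ideals_set ?R\<^esub> r" if C: "C \<in> ?MC" for C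
      proof (rule mem_ideal_if_monoms[OF pow])
        show "f * Poly_Mapping.single (t C) 1 \<in> carrier ?R"
          using f m_closed[OF _ t_carrier, of f] by simp
        fix k assume "k \<in> Poly_Mapping.keys (f * Poly_Mapping.single (t C) 1)"
        then obtain m where k: "k = m + t C" and m: "m \<in> Poly_Mapping.keys f"
          by (auto elim!: mult_keysE)
        have "r \<le> cdeg C m" "Poly_Mapping.keys m \<subseteq> {1..n}"
          using f m C by (auto simp: carrier_poly_ring)
        then show "Poly_Mapping.single k 1 \<in> I [^]\<^bsub>ideals_set ?R\<^esub> r"
          unfolding k t_def using C by (intro monom_mem_pow) auto
      qed
      then show ?thesis
        unfolding s_def sum_distrib_left by (rule sum_mem_ideal[OF pow])
    qed
    ultimately show "f \<in> symbolic_power ?R I r" using sym f by blast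
  qed
qed

text \<open>Each cover contains a minimal one, and enlarging a set of variables cannot lower the
  degree.\<close>

lemma cdeg_ge_all_vertex_covers:
  "(\<forall>C. minimal_vertex_cover {1..n} E C \<longrightarrow> r \<le> cdeg C m) \<longleftrightarrow>
   (\<forall>C. vertex_cover {1..n} E C \<longrightarrow> r \<le> cdeg C m)"
proof (intro iffI allI impI)
  fix D assume min: "\<forall>C. minimal_vertex_cover {1..n} E C \<longrightarrow> r \<le> cdeg C m"
    and D: "vertex_cover {1..n} E D"
  obtain C where "minimal_vertex_cover {1..n} E C" "C \<subseteq> D"
    using obtain_minimal_vertex_cover[OF _ D] by auto
  moreover have "cdeg C m \<le> cdeg D m"
    unfolding cdeg_def using \<open>C \<subseteq> D\<close> vertex_cover_finite[OF D] by (intro sum_mono2) auto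
  ultimately show "r \<le> cdeg D m" using min le_trans by blast
qed (simp add: minimal_vertex_cover_def)

end

section \<open>Clique monomials\<close>

definition indicator_exponent :: "nat set \<Rightarrow> nat \<Rightarrow>\<^sub>0 nat" where
  "indicator_exponent V = (\<Sum>i\<in>V. Poly_Mapping.single i 1)"

lemma lookup_indicator_exponent:
  "finite V \<Longrightarrow> Poly_Mapping.lookup (indicator_exponent V) x = of_bool (x \<in> V)"
  by (auto simp: indicator_exponent_def lookup_sum lookup_single when_def)

lemma prod_single:
  "(\<Prod>i\<in>A. Poly_Mapping.single (g i) 1) = (Poly_Mapping.single (\<Sum>i\<in>A. g i) 1 :: 'k::comm_ring_1 mpoly)"
  by (induction A rule: infinite_finite_induct) (simp_all add: mult_single)

lemma sqfree_monom_eq: "sqfree_monom V = Poly_Mapping.single (indicator_exponent V) 1"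
  by (simp add: sqfree_monom_def var_def prod_single indicator_exponent_def)

definition clique_exponents :: "nat \<Rightarrow> nat set set \<Rightarrow> nat \<Rightarrow> (nat \<Rightarrow>\<^sub>0 nat) set" where
  "clique_exponents n E r = {\<Sum>i=1..l. indicator_exponent (V i) | (l::nat) V.
     l \<ge> 1 \<and> (\<forall>i\<in>{1..l}. V i \<in> cliques 2 {1..n} E) \<and> (\<Sum>i=1..l. (card (V i) - 1)) = r}"

lemma clique_monoms_eq:
  "{\<Prod>i=1..l. sqfree_monom (V i) | (l::nat) V.
      l \<ge> 1 \<and> (\<forall>i\<in>{1..l}. V i \<in> cliques 2 {1..n} E) \<and> (\<Sum>i=1..l. (card (V i) - 1)) = r}
   = (\<lambda>g. Poly_Mapping.single g 1 :: 'k::comm_ring_1 mpoly) ` clique_exponents n E r"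
  unfolding sqfree_monom_eq prod_single clique_exponents_def by blast

lemma sum_nth_eq:
  fixes f :: "'a \<Rightarrow> 'b::comm_monoid_add"
  shows "(\<Sum>i=1..length Ks. f (Ks ! (i - 1))) = (\<Sum>K\<leftarrow>Ks. f K)"
proof -
  have "(\<Sum>i=1..length Ks. f (Ks ! (i - 1))) = (\<Sum>i<length Ks. f (Ks ! i))"
    by (rule sum.reindex_bij_witness[of _ Suc "\<lambda>i. i - 1"]) auto
  then show ?thesis by (simp add: sum_list_sum_nth atLeast0LessThan)
qed

text \<open>Cliques may repeat, so families indexed by \<open>{1..l}\<close> amount to lists. The
  condition \<open>l \<ge> 1\<close> disappears because the empty list has total
  \<open>0 < r\<close>.\<close>

lemma clique_exponents_lists:
  assumes "r \<ge> 1"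
  shows "clique_exponents n E r = {(\<Sum>K\<leftarrow>Ks. indicator_exponent K) | Ks.
    set Ks \<subseteq> cliques 2 {1..n} E \<and> (\<Sum>K\<leftarrow>Ks. card K - 1) = r}" (is "_ = ?S")
proof (intro equalityI subsetI)
  fix g assume "g \<in> clique_exponents n E r"
  then obtain l :: nat and V where V: "g = (\<Sum>i=1..l. indicator_exponent (V i))"
    "\<forall>i\<in>{1..l}. V i \<in> cliques 2 {1..n} E" "(\<Sum>i=1..l. (card (V i) - 1)) = r"
    unfolding clique_exponents_def by blast
  define Ks where "Ks = map V [1..<Suc l]"
  have sum_Ks: "(\<Sum>K\<leftarrow>Ks. f K) = (\<Sum>i=1..l. f (V i))" for f :: "nat set \<Rightarrow> 'b::comm_monoid_add"
    unfolding Ks_def by (simp add: interv_sum_list_conv_sum_set_nat o_def atLeastLessThanSuc_atLeastAtMost del: upt_Suc)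
  have "set Ks \<subseteq> cliques 2 {1..n} E" using V(2) by (auto simp: Ks_def)
  then show "g \<in> ?S" using V(1,3) by (auto simp: sum_Ks intro!: exI[of _ Ks])
next
  fix g assume "g \<in> ?S"
  then obtain Ks where Ks: "g = (\<Sum>K\<leftarrow>Ks. indicator_exponent K)"
    "set Ks \<subseteq> cliques 2 {1..n} E" "(\<Sum>K\<leftarrow>Ks. card K - 1) = r" by blast
  have "length Ks \<ge> 1" using Ks(3) assms by (cases Ks) auto
  moreover have "\<forall>i\<in>{1..length Ks}. Ks ! (i - 1) \<in> cliques 2 {1..n} E"
    by (intro ballI subsetD[OF Ks(2)] nth_mem) auto
  ultimately show "g \<in> clique_exponents n E r"
    unfolding clique_exponents_def
    using sum_nth_eq[of indicator_exponent Ks] sum_nth_eq[of "\<lambda>K. card K - 1" Ks] Ks(1,3)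
    by (intro CollectI exI[of _ "length Ks"] exI[of _ "\<lambda>i. Ks ! (i - 1)"]) auto
qed

text \<open>The cofactor is \<open>m - g\<close>. Its truncation is harmless: the packing bounds
  \<open>g\<close> by \<open>m\<close> on \<open>{1..n}\<close>, and the cliques have no vertex
  elsewhere.\<close>

lemma dvd_clique_exponents_iff:
  assumes "r \<ge> 1"
  shows "m \<in> {g + h | g h. g \<in> clique_exponents n E r} \<longleftrightarrow> packs {1..n} E (Poly_Mapping.lookup m) r"
proof -
  have lookup: "Poly_Mapping.lookup (\<Sum>K\<leftarrow>Ks. indicator_exponent K) x = (\<Sum>K\<leftarrow>Ks. of_bool (x \<in> K))"
    if "set Ks \<subseteq> cliques 2 {1..n} E" for Ks x
    using that
  proof (induction Ks)
    case (Cons K Ks)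
    then have "finite K" by (auto simp: cliques_def intro: finite_subset)
    then show ?case using Cons by (simp add: lookup_add lookup_indicator_exponent)
  qed simp
  show ?thesis
  proof
    assume "m \<in> {g + h | g h. g \<in> clique_exponents n E r}"
    then obtain Ks h where "m = (\<Sum>K\<leftarrow>Ks. indicator_exponent K) + h"
      "set Ks \<subseteq> cliques 2 {1..n} E" "(\<Sum>K\<leftarrow>Ks. card K - 1) = r"
      unfolding clique_exponents_lists[OF assms] by blast
    then show "packs {1..n} E (Poly_Mapping.lookup m) r"
      unfolding packs_def by (intro exI[of _ Ks]) (simp add: lookup_add lookup)
  next
    assume "packs {1..n} E (Poly_Mapping.lookup m) r"
    then obtain Ks where Ks: "set Ks \<subseteq> cliques 2 {1..n} E" "(\<Sum>K\<leftarrow>Ks. card K - 1) = r"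
      "\<And>x. x \<in> {1..n} \<Longrightarrow> (\<Sum>K\<leftarrow>Ks. of_bool (x \<in> K)) \<le> Poly_Mapping.lookup m x"
      unfolding packs_def by blast
    let ?g = "\<Sum>K\<leftarrow>Ks. indicator_exponent K"
    have "Poly_Mapping.lookup ?g x \<le> Poly_Mapping.lookup m x" for x
    proof (cases "x \<in> {1..n}")
      case False
      then have "x \<notin> K" if "K \<in> set Ks" for K
        using Ks(1) that unfolding cliques_def by blast
      then have "(\<Sum>K\<leftarrow>Ks. of_bool (x \<in> K)) = (0::nat)" by simp
      then show ?thesis by (metis lookup[OF Ks(1)] le0)
    qed (use Ks lookup in simp)
    then have "m = ?g + (m - ?g)"
      by (intro poly_mapping_eqI) (simp add: lookup_add lookup_minus)
    then show "m \<in> {g + h | g h. g \<in> clique_exponents n E r}"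
      unfolding clique_exponents_lists[OF assms] using Ks(1,2) by blast
  qed
qed

theorem theorem3p10:
  fixes n :: nat and E :: "nat set set"
  assumes "E \<subseteq> [{1..n}]\<^bsup>2\<^esup>"
  shows "perfect_graph {1..n} E \<longleftrightarrow>
    (\<forall>r\<ge>1. symbolic_power (poly_ring n) (edge_ideal n E :: 'k::alg_closed_field mpoly set) r =
       Idl\<^bsub>poly_ring n\<^esub> {\<Prod>i=1..l. sqfree_monom (V i) | (l::nat) V.
         l \<ge> 1 \<and> (\<forall>i\<in>{1..l}. V i \<in> cliques 2 {1..n} E) \<and> (\<Sum>i=1..l. (card (V i) - 1)) = r})"
    (is "_ \<longleftrightarrow> (\<forall>r\<ge>1. ?sym r = Idl\<^bsub>poly_ring n\<^esub> ?gens r)")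
proof -
  interpret graph_ideal n E "edge_ideal n E :: 'k mpoly set"
    by unfold_locales (use assms in auto)
  let ?cov = "\<lambda>w r. \<forall>C. vertex_cover {1..n} E C \<longrightarrow> r \<le> sum w C"
  have eq_iff: "?sym r = Idl\<^bsub>poly_ring n\<^esub> ?gens r \<longleftrightarrow> (\<forall>w. ?cov w r \<longrightarrow> packs {1..n} E w r)"
    if r: "r \<ge> 1" for r
  proof -
    have sym: "?sym r = monom_ideal n {m. ?cov (Poly_Mapping.lookup m) r}"
      using symbolic_power_eq[OF r] cdeg_ge_all_vertex_covers[of r]
      by (auto simp: monom_ideal_def cdeg_def)
    have gens: "Poly_Mapping.keys g \<subseteq> {1..n}" if g: "g \<in> clique_exponents n E r" for g
    proof
      fix x assume x: "x \<in> Poly_Mapping.keys g"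
      obtain l :: nat and V where V: "g = (\<Sum>i=1..l. indicator_exponent (V i))"
        "\<forall>i\<in>{1..l}. V i \<in> cliques 2 {1..n} E"
        using g unfolding clique_exponents_def by blast
      have "Poly_Mapping.lookup g x \<noteq> 0" using x by (simp add: in_keys_iff)
      then obtain i where i: "i \<in> {1..l}" "Poly_Mapping.lookup (indicator_exponent (V i)) x \<noteq> 0"
        unfolding V(1) lookup_sum by (meson sum.neutral)
      have "V i \<subseteq> {1..n}" using V(2) i(1) by (simp add: cliques_def)
      moreover from this have "finite (V i)" by (rule finite_subset) simp
      ultimately show "x \<in> {1..n}" using i(2) by (auto simp: lookup_indicator_exponent)
    qed
    have rhs: "Idl\<^bsub>poly_ring n\<^esub> ?gens r =
        (monom_ideal n {m. packs {1..n} E (Poly_Mapping.lookup m) r} :: 'k mpoly set)"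
    proof -
      have "Idl\<^bsub>poly_ring n\<^esub> ?gens r =
          (monom_ideal n {g + h | g h. g \<in> clique_exponents n E r} :: 'k mpoly set)"
        unfolding clique_monoms_eq by (rule Idl_monoms[OF gens])
      also have "{g + h | g h. g \<in> clique_exponents n E r} = {m. packs {1..n} E (Poly_Mapping.lookup m) r}"
        using dvd_clique_exponents_iff[OF r] by blast
      finally show ?thesis .
    qed
    have "?sym r = Idl\<^bsub>poly_ring n\<^esub> ?gens r \<longleftrightarrow> (\<forall>m. Poly_Mapping.keys m \<subseteq> {1..n} \<longrightarrow>
        (?cov (Poly_Mapping.lookup m) r \<longleftrightarrow> packs {1..n} E (Poly_Mapping.lookup m) r))"
      unfolding sym rhs monom_ideal_eq_iff by simp
    \<comment> \<open>Every generator lies in the symbolic power, for any graph; only the reverse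
      inclusion remains as a condition.\<close>
    also have "\<dots> \<longleftrightarrow> (\<forall>m. Poly_Mapping.keys m \<subseteq> {1..n} \<longrightarrow>
        ?cov (Poly_Mapping.lookup m) r \<longrightarrow> packs {1..n} E (Poly_Mapping.lookup m) r)"
      using cover_degree_if_packs[of "{1..n}" E] by (meson finite_atLeastAtMost)
    also have "\<dots> \<longleftrightarrow> (\<forall>w. ?cov w r \<longrightarrow> packs {1..n} E w r)"
    proof (intro iffI allI impI)
      fix w :: "nat \<Rightarrow> nat"
      assume mon: "\<forall>m. Poly_Mapping.keys m \<subseteq> {1..n} \<longrightarrow>
          ?cov (Poly_Mapping.lookup m) r \<longrightarrow> packs {1..n} E (Poly_Mapping.lookup m) r"
        and w: "?cov w r"
      \<comment> \<open>Weights are arbitrary functions, exponents are finitely supported. Covers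
        and packings see \<open>w\<close> only on \<open>{1..n}\<close>, so it may be cut off
        there.\<close>
      define m where "m = (\<Sum>i\<in>{1..n}. Poly_Mapping.single i (w i))"
      have m: "Poly_Mapping.lookup m x = (if x \<in> {1..n} then w x else 0)" for x
        by (simp add: m_def lookup_sum lookup_single when_def)
      have "sum (Poly_Mapping.lookup m) C = sum w C" if "vertex_cover {1..n} E C" for C
        using that m by (intro sum.cong) (auto simp: vertex_cover_def)
      moreover have "Poly_Mapping.keys m \<subseteq> {1..n}"
        using m by (auto simp: in_keys_iff split: if_splits)
      ultimately have "packs {1..n} E (Poly_Mapping.lookup m) r" using mon w by simp
      then show "packs {1..n} E w r" by (rule packs_mono) (simp add: m)
    qed blast
    finally show ?thesis .
  qed
  show ?thesis
    unfolding perfect_graph_iff_packs[OF finite_atLeastAtMost assms] using eq_iff by simp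
qed

end
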